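(* Let $W, W_1,W_2,\dots$ be i.i.d. random vectors in $\mathbb{R}^m$ (with the samples $W_1,\dots,W_n$ distinct), let $h:\mathbb{R}^m\times\mathbb{R}^l\to\mathbb{R}^r$, and assume: A1) $c(u,w)=\|u-w\|_q$ (that is, exponent $\rho=1$) with $q\ge1$, and $p$ is such that $1/p+1/q=1$; A2) $\theta_*\in\mathbb{R}^l$ satisfies $\mathbb{E}[h(W,\theta_* )]=\mathbf 0$ and $\mathbb{E}\|h(W,\theta_* )\|_2^2<\infty$; A3) $h(\cdot,\theta_* )$ is continuously differentiable with derivative $D_wh(\cdot,\theta_* )$; A4) for each $\zeta\in\mathbb{R}^r$, $\zeta\ne0$, $\ \Pr\big(\|\zeta^TD_wh(W,\theta_* )\|_p>0\big)>0$. Suppose in addition that $W$ has a positive density (almost everywhere) with respect to Lebesgue measure. Let $R_n(\theta;1)=\inf\{\mathcal{D}_c(\mathbb{P},\mathbb{P}_n):\mathbb{E}_{\mathbb{P}}[h(W,\theta)]=\mathbf 0\}$. Then, as $n\to\infty$, $$n^{1/2}R_n(\theta_*;1)\Rightarrow\bar R(1):=\max\Big\{\zeta^TH:\ \zeta\in\mathbb{R}^r,\ \Pr\big(\|\zeta^TD_wh(W,\theta_* )\|_p>1\big)=0\Big\},$$ where $H\sim\mathcal{N}(\mathbf 0,\mathbb{E}[h(W,\theta_* )h(W,\theta_* )^T])$.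
   Context: $\Rightarrow$ denotes convergence in distribution. $\mathbb{P}_n=\frac1n\sum_{i=1}^n\delta_{W_i}$. For a cost $c$, $\mathcal{D}_c(\mathbb{P},\mathbb{Q})=\inf\{\mathbb{E}_\pi[c(U,W)]\}$ over joint distributions $\pi$ on $\mathbb{R}^m\times\mathbb{R}^m$ with marginals $\pi_U=\mathbb{P}$, $\pi_W=\mathbb{Q}$. The infimum in $R_n$ is over Borel probability measures $\mathbb{P}$ on $\mathbb{R}^m$ (with $W\sim\mathbb{P}$ under $\mathbb{E}_{\mathbb{P}}$). $D_wh$ is the $r\times m$ Jacobian in the first argument. In A1, $q=\infty$ (with $p=1$) is allowed. *)

theory Defs
  imports "HOL-Probability.Probability"
begin

text \<open>The exponent is extended, so that \<^term>\<open>1 / p + 1 / q = (1::ennreal)\<close> covers the conjugate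
  pairs \<^term>\<open>(1, \<infinity>)\<close> and \<^term>\<open>(\<infinity>, 1)\<close> (where \<^term>\<open>1 / \<infinity> = (0::ennreal)\<close>).\<close>

definition lp_norm :: "ennreal \<Rightarrow> real^'n \<Rightarrow> real" where
  "lp_norm p x =
     (if p = \<infinity> then infnorm x
      else (\<Sum>i\<in>UNIV. \<bar>x $ i\<bar> powr enn2real p) powr (1 / enn2real p))"

text \<open>The average of the unit masses at \<open>w 0, \<dots>, w (n - 1)\<close>, for \<open>n > 0\<close>.\<close>

definition empirical_measure :: "nat \<Rightarrow> (nat \<Rightarrow> 'w::topological_space) \<Rightarrow> 'w measure" where
  "empirical_measure n w = distr (uniform_count_measure {..<n}) borel w"

lemma emeasure_empirical_measure:
  assumes "A \<in> sets borel"
  shows "emeasure (empirical_measure n w) A = card {i. i < n \<and> w i \<in> A} / n"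
proof -
  let ?I = "{i. i < n \<and> w i \<in> A}"
  have *: "w -` A \<inter> {..<n} = ?I" and sub: "?I \<subseteq> {..<n}" by auto
  have "w \<in> measurable (uniform_count_measure {..<n}) borel"
    by (simp add: measurable_def space_uniform_count_measure sets_uniform_count_measure)
  then have "emeasure (empirical_measure n w) A = emeasure (uniform_count_measure {..<n}) ?I"
    using assms unfolding empirical_measure_def
    by (simp add: emeasure_distr space_uniform_count_measure *)
  also have "\<dots> = card ?I / n"
    using emeasure_uniform_count_measure[OF finite_lessThan sub] by simp
  finally show ?thesis .
qed

definition couplings ::
    "'w::topological_space measure \<Rightarrow> 'w measure \<Rightarrow> ('w \<times> 'w) measure set" where
  "couplings P Q =
     {\<pi>. prob_space \<pi> \<and> sets \<pi> = sets borel \<and> distr \<pi> borel fst = P \<and> distr \<pi> borel snd = Q}"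

definition transport_cost ::
    "('w \<Rightarrow> 'w \<Rightarrow> real) \<Rightarrow> 'w::topological_space measure \<Rightarrow> 'w measure \<Rightarrow> ennreal" where
  "transport_cost c P Q = (INF \<pi>\<in>couplings P Q. \<integral>\<^sup>+z. ennreal (c (fst z) (snd z)) \<partial>\<pi>)"

text \<open>Integrability must be required explicitly because the Bochner integral of a non-integrable
  function is \<open>0\<close>. The profile function is \<open>\<infinity>\<close> if no competitor is at finite cost.\<close>

definition profile_function ::
    "('w \<Rightarrow> 'w \<Rightarrow> real) \<Rightarrow> ('w::topological_space \<Rightarrow> 'l \<Rightarrow> 'r::euclidean_space)
      \<Rightarrow> nat \<Rightarrow> (nat \<Rightarrow> 'w) \<Rightarrow> 'l \<Rightarrow> ennreal" where
  "profile_function c h n w \<theta> =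
     (INF P\<in>{P. prob_space P \<and> sets P = sets borel \<and>
                integrable P (\<lambda>u. h u \<theta>) \<and> (\<integral>u. h u \<theta> \<partial>P) = 0}.
        transport_cost c P (empirical_measure n w))"

text \<open>Gaussian vector: every linear functional is univariate normal, degenerate laws included, so
  that \<open>S\<close> may be singular.\<close>

definition multivariate_normal ::
    "'a measure \<Rightarrow> ('a \<Rightarrow> real^'r) \<Rightarrow> real^'r \<Rightarrow> real^'r^'r \<Rightarrow> bool" where
  "multivariate_normal N H \<mu> S \<longleftrightarrow>
     H \<in> borel_measurable N \<and>
     (\<forall>t. let v = t \<bullet> (S *v t) in
        (v > 0 \<and>
          distributed N lborel (\<lambda>\<omega>. t \<bullet> H \<omega>) (\<lambda>x. ennreal (normal_density (t \<bullet> \<mu>) (sqrt v) x))) \<or>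
        (v = 0 \<and> (AE \<omega> in N. t \<bullet> H \<omega> = t \<bullet> \<mu>)))"

text \<open>Weak convergence of the laws of the \<open>X n\<close> to the law of \<open>Y\<close>. The variables may take values in
  any topological space, in particular in \<^typ>\<open>ennreal\<close>; \<^const>\<open>weak_conv_m\<close> only covers
  \<^typ>\<open>real\<close>.\<close>

definition converges_in_distribution ::
    "'a measure \<Rightarrow> (nat \<Rightarrow> 'a \<Rightarrow> 'c::topological_space) \<Rightarrow> 'b measure \<Rightarrow> ('b \<Rightarrow> 'c) \<Rightarrow> bool" where
  "converges_in_distribution M X N Y \<longleftrightarrow>
     (\<forall>n. X n \<in> borel_measurable M) \<and> Y \<in> borel_measurable N \<and>
     (\<forall>f::'c \<Rightarrow> real. continuous_on UNIV f \<longrightarrow> bounded (range f) \<longrightarrow>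
        (\<lambda>n. \<integral>\<omega>. f (X n \<omega>) \<partial>M) \<longlonglongrightarrow> (\<integral>\<omega>. f (Y \<omega>) \<partial>N))"

end

theory Submission
  imports Defs
begin

text \<open>With \<open>g = h (\<cdot>, \<theta>)\<close>, the positive density and the continuity of the derivative turn the
  almost sure constraint defining \<open>K\<close> into: \<open>\<zeta> \<bullet> g\<close> is 1-Lipschitz for the cost. Integrating this
  against a coupling bounds the profile function below by \<open>S (mean of g)\<close>, where \<open>S\<close> is the support
  function of \<open>K\<close>. Conversely, for \<open>\<epsilon> > 0\<close> finitely many pairs of an open set \<open>A\<close> and a point \<open>b\<close>
  witness that no \<open>\<zeta>\<close> at distance at least \<open>\<epsilon>\<close> from \<open>K\<close> satisfies the Lipschitz condition; moving
  a small part of the mass of the sample points in the sets \<open>A\<close> to the points \<open>b\<close> then cancels the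
  mean at cost at most \<open>S (mean) + \<epsilon> |mean|\<close>, by separation of a point from a polytope. The fraction
  of sample points in each \<open>A\<close> stays away from \<open>0\<close>, whereas the required mass tends to \<open>0\<close>. So the
  scaled profile function has the same limit as \<open>S\<close> of the scaled mean, which follows from the
  multivariate central limit theorem. The latter is obtained from the one-dimensional theorem along
  each direction, because trigonometric polynomials are dense among the continuous functions on a
  ball and the scaled means are tight.\<close>

section \<open>Conjugate norms\<close>

text \<open>With exponent one, cost is mass times distance, so a vanishing mass can be carried over
  a fixed distance at vanishing cost, and there is no need to shift every sample point a little.
  This is why witnesses made of a set \<open>A\<close> and a distant point \<open>b\<close> suffice.
  Each witness needs its own law of large numbers event, so only finitely many of the inequalities
  that define \<open>K\<close> can be exploited. Finitely many need not cut out \<open>K\<close>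
  itself; they only have to exclude the points at distance at least \<epsilon>. This is the origin
  of the slack, and its price, \<epsilon> times the norm of the scaled mean, is harmless because the
  scaled means are tight. A4 enters through the boundedness of \<open>K\<close>, and the symmetry of
  the cost makes \<open>K\<close> symmetric about 0, so the mean and its negative lead to the same
  bound. The lower bound holds for every nonempty sample, the upper bound only off an event of
  vanishing probability, where the profile may be infinite; hence the limit is taken in
  \<open>ennreal\<close>.\<close>

lemma lp_norm_top: "lp_norm \<top> x = infnorm x"
  by (simp add: lp_norm_def)

lemma lp_norm_ennreal:
  "P \<ge> 0 \<Longrightarrow> lp_norm (ennreal P) x = (\<Sum>i\<in>UNIV. \<bar>x $ i\<bar> powr P) powr (1 / P)"
  by (simp add: lp_norm_def)

lemma lp_norm_1: "lp_norm 1 x = (\<Sum>i\<in>UNIV. \<bar>x $ i\<bar>)"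
  by (simp add: lp_norm_def sum_nonneg)

lemma one_le_ennrealE:
  assumes "1 \<le> (p::ennreal)"
  obtains "p = \<top>" | P where "P \<ge> 1" "p = ennreal P"
proof (cases p)
  case (real r)
  with assms have "r \<ge> 1"
    by (metis ennreal_1 ennreal_le_iff)
  with real that show thesis by blast
qed (use that in auto)

text \<open>Each summand of the identity is at most one; the exponent zero is excluded because
  \<open>1 / 0 = \<top>\<close> in \<open>ennreal\<close>.\<close>

lemma conjugate_exponent_ge_1:
  fixes p q :: ennreal
  assumes "1 / p + 1 / q = 1"
  shows "p \<ge> 1"
proof -
  have "1 / p \<le> 1"
    using assms by (metis le_iff_add)
  then show ?thesis
  proof (cases p)
    case (real r)
    show ?thesis
    proof (cases "r = 0")
      case True
      then show ?thesis using real \<open>1 / p \<le> 1\<close> by (simp add: top_unique)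
    next
      case False
      then have "ennreal (1 / r) \<le> 1"
        using real \<open>1 / p \<le> 1\<close> divide_ennreal[of 1 r] by simp
      then show ?thesis using False real by (simp add: ennreal_ge_1 divide_simps)
    qed
  qed auto
qed

lemma conjugate_exponentE:
  fixes p q :: ennreal
  assumes "1 / p + 1 / q = 1"
  obtains "p = 1" "q = \<top>" | "p = \<top>" "q = 1"
  | P Q where "P > 1" "Q > 1" "1 / P + 1 / Q = 1" "p = ennreal P" "q = ennreal Q"
proof -
  have pq: "p \<ge> 1" "q \<ge> 1"
    using assms conjugate_exponent_ge_1[of p q] conjugate_exponent_ge_1[of q p]
    by (auto simp: add.commute)
  have top: "r = 1" if "1 / r = 1" "r \<ge> 1" for r :: ennreal
    using that by (cases r) (auto simp: ennreal_divide_top divide_ennreal simp flip: ennreal_1)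
  from pq(1) show thesis
  proof (cases rule: one_le_ennrealE)
    case 1
    then show thesis using assms pq that(2) top by (simp add: ennreal_divide_top)
  next
    case (2 P)
    note P = this
    from pq(2) show thesis
    proof (cases rule: one_le_ennrealE)
      case 1
      then show thesis using assms pq that(1) top by (simp add: ennreal_divide_top)
    next
      case (2 Q)
      have "ennreal (1 / P + 1 / Q) = 1"
        using assms P 2 by (simp add: divide_ennreal ennreal_plus flip: ennreal_1)
      then have "1 / P + 1 / Q = 1"
        using P 2 by (metis ennreal_1 ennreal_inj add_nonneg_nonneg zero_le_divide_1_iff zero_le_one order_trans)
      moreover from this have "P > 1" "Q > 1"
        using P 2 by (auto simp: less_le)
      ultimately show thesis using that(3) P 2 by blast
    qed
  qed
qed

lemma lp_norm_nonneg: "0 \<le> lp_norm p x"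
  by (simp add: lp_norm_def infnorm_pos_le)

lemma lp_norm_0 [simp]: "lp_norm p 0 = 0"
  by (cases "enn2real p = 0") (auto simp: lp_norm_def infnorm_0)

lemma lp_norm_scaleR:
  assumes "p \<ge> 1"
  shows "lp_norm p (c *\<^sub>R x) = \<bar>c\<bar> * lp_norm p x"
  using assms
proof (cases rule: one_le_ennrealE)
  case 1
  then show ?thesis by (simp add: lp_norm_top infnorm_mul)
next
  case (2 P)
  then show ?thesis
    by (simp add: lp_norm_ennreal abs_mult powr_mult sum_nonneg powr_powr flip: sum_distrib_left)
qed

lemma lp_norm_minus: "lp_norm p (- x) = lp_norm p x"
  by (simp add: lp_norm_def infnorm_neg)

lemma lp_norm_eq_0_iff:
  assumes "p \<ge> 1"
  shows "lp_norm p x = 0 \<longleftrightarrow> x = 0"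
  using assms
proof (cases rule: one_le_ennrealE)
  case 1
  then show ?thesis by (simp add: lp_norm_top infnorm_eq_0)
next
  case (2 P)
  then show ?thesis
    by (auto simp: lp_norm_ennreal sum_nonneg_eq_0_iff vec_eq_iff)
qed

lemma continuous_on_lp_norm:
  assumes "p \<ge> 1"
  shows "continuous_on UNIV (lp_norm p :: real^'n \<Rightarrow> real)"
  using assms
proof (cases rule: one_le_ennrealE)
  case 1
  then show ?thesis
    by (simp add: lp_norm_top[abs_def] continuous_on_infnorm continuous_on_id)
next
  case (2 P)
  then have "lp_norm p = (\<lambda>x::real^'n. (\<Sum>i\<in>UNIV. \<bar>x $ i\<bar> powr P) powr (1 / P))"
    by (auto simp: lp_norm_ennreal)
  then show ?thesis
    using 2 by (auto intro!: continuous_intros continuous_on_powr' sum_nonneg)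
qed

text \<open>One componentwise estimate serves both endpoint pairs, by symmetry of the inner product.
  For finite exponents both vectors are normalised and Young's inequality is summed over the
  components; the right-hand sides add up to \<open>1 / P + 1 / Q\<close>.\<close>

lemma lp_norm_Holder:
  fixes x y :: "real^'n"
  assumes "1 / p + 1 / q = 1"
  shows "x \<bullet> y \<le> lp_norm p x * lp_norm q y"
proof -
  have *: "x \<bullet> y \<le> lp_norm 1 x * lp_norm \<top> y" for x y :: "real^'n"
  proof -
    have "x \<bullet> y = (\<Sum>i\<in>UNIV. x $ i * y $ i)"
      by (simp add: inner_vec_def)
    also have "\<dots> \<le> (\<Sum>i\<in>UNIV. \<bar>x $ i\<bar> * infnorm y)"
    proof (rule sum_mono)
      fix i
      have "x $ i * y $ i \<le> \<bar>x $ i\<bar> * \<bar>y $ i\<bar>"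
        by (metis abs_ge_self abs_mult)
      also have "\<dots> \<le> \<bar>x $ i\<bar> * infnorm y"
        by (intro mult_left_mono component_le_infnorm_cart) auto
      finally show "x $ i * y $ i \<le> \<bar>x $ i\<bar> * infnorm y" .
    qed
    finally show ?thesis
      by (simp add: lp_norm_1 lp_norm_top sum_distrib_right)
  qed
  from assms show ?thesis
  proof (cases rule: conjugate_exponentE)
    case 1
    then show ?thesis using * by simp
  next
    case 2
    then show ?thesis using *[of y x] by (simp add: inner_commute mult.commute)
  next
    case (3 P Q)
    have ge: "p \<ge> 1" "q \<ge> 1"
      using assms conjugate_exponent_ge_1[of p q] conjugate_exponent_ge_1[of q p]
      by (auto simp: add.commute)
    show ?thesis
    proof (cases "x = 0 \<or> y = 0")
      case False
      define a b where "a = lp_norm p x" and "b = lp_norm q y"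
      have ab: "a > 0" "b > 0"
        using False lp_norm_nonneg[of p x] lp_norm_nonneg[of q y]
          lp_norm_eq_0_iff[OF ge(1), of x] lp_norm_eq_0_iff[OF ge(2), of y]
        by (auto simp: a_def b_def less_le)
      have pw: "(\<Sum>i\<in>UNIV. \<bar>z $ i / lp_norm (ennreal R) z\<bar> powr R) = 1"
        if "lp_norm (ennreal R) z > 0" "R > 1" for z :: "real^'n" and R
      proof -
        have "lp_norm (ennreal R) z powr R = (\<Sum>i\<in>UNIV. \<bar>z $ i\<bar> powr R)"
          using that(2) by (simp add: lp_norm_ennreal powr_powr sum_nonneg)
        moreover from this have "(\<Sum>i\<in>UNIV. \<bar>z $ i\<bar> powr R) \<noteq> 0"
          using that(1) by (metis less_irrefl powr_gt_zero)
        ultimately show ?thesis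
          using that by (simp add: powr_divide abs_divide flip: sum_divide_distrib)
      qed
      have "x \<bullet> y / (a * b) = (\<Sum>i\<in>UNIV. x $ i / a * (y $ i / b))"
        by (simp add: inner_vec_def sum_divide_distrib)
      also have "\<dots> \<le> (\<Sum>i\<in>UNIV. \<bar>x $ i / a\<bar> powr P / P + \<bar>y $ i / b\<bar> powr Q / Q)"
      proof (rule sum_mono)
        fix i
        have "x $ i / a * (y $ i / b) \<le> \<bar>x $ i / a\<bar> * \<bar>y $ i / b\<bar>"
          by (metis abs_ge_self abs_mult)
        also have "\<dots> \<le> \<bar>x $ i / a\<bar> powr P / P + \<bar>y $ i / b\<bar> powr Q / Q"
          using 3 by (intro Youngs_inequality) auto
        finally show "x $ i / a * (y $ i / b) \<le> \<bar>x $ i / a\<bar> powr P / P + \<bar>y $ i / b\<bar> powr Q / Q" .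
      qed
      also have "\<dots> = 1 / P + 1 / Q"
        using ab 3 pw[of P x] pw[of Q y]
        by (simp add: sum.distrib a_def b_def flip: sum_divide_distrib)
      finally show ?thesis
        using ab 3 by (simp add: a_def b_def divide_simps)
    qed auto
  qed
qed

text \<open>The witnesses are the equality cases of the Hoelder inequality: a signed unit vector at
  a largest coordinate, the vector of all signs, and a power of \<open>y\<close> with signs. Norms
  are handled below through this duality.\<close>

lemma lp_norm_attained:
  fixes y :: "real^'n"
  assumes "1 / p + 1 / q = 1"
  obtains x where "lp_norm p x \<le> 1" "x \<bullet> y = lp_norm q y"
proof -
  from assms show thesis
  proof (cases rule: conjugate_exponentE)
    case 1
    have "infnorm y \<in> (\<lambda>b. \<bar>y \<bullet> b\<bar>) ` Basis"
      unfolding infnorm_Max by (intro Max_in) auto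
    then obtain i where i: "infnorm y = \<bar>y $ i\<bar>"
      by (auto simp: Basis_vec_def inner_axis)
    define x where "x = axis i (sgn (y $ i))"
    have "lp_norm p x \<le> 1"
      using 1 by (simp add: lp_norm_1 x_def axis_def if_distrib[of abs] abs_sgn_eq cong: if_cong)
    moreover have "x \<bullet> y = lp_norm q y"
      using 1 i by (simp add: lp_norm_top x_def inner_commute[of _ y] inner_axis mult.commute[of _ "sgn _"] mult_sgn_abs
           linordered_idom_class.abs_sgn)
    ultimately show thesis by (rule that)
  next
    case 2
    define x where "x = (\<chi> i. sgn (y $ i))"
    have "lp_norm p x \<le> 1"
      using 2 by (auto simp: lp_norm_top x_def infnorm_Max Basis_vec_def inner_axis abs_sgn_eq)
    moreover have "x \<bullet> y = lp_norm q y"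
      using 2 by (simp add: lp_norm_1 x_def inner_vec_def linordered_idom_class.abs_sgn mult.commute)
    ultimately show thesis by (rule that)
  next
    case (3 P Q)
    have Q: "(Q - 1) * P = Q"
      using 3 by (simp add: field_simps)
    define S where "S = (\<Sum>i\<in>UNIV. \<bar>y $ i\<bar> powr Q)"
    have S: "S \<ge> 0" by (simp add: S_def sum_nonneg)
    \<comment> \<open>Equality in Young's inequality requires
      \<open>\<bar>x $ i\<bar> powr P\<close> to be proportional to
      \<open>\<bar>y $ i\<bar> powr Q\<close>, which gives the exponent \<open>Q - 1\<close> because
      \<open>(Q - 1) * P = Q\<close>. The power of \<open>S\<close> normalises
      \<open>x\<close>.\<close>
    define x where "x = (\<chi> i. sgn (y $ i) * \<bar>y $ i\<bar> powr (Q - 1) * S powr (- 1 / P))"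
    show thesis
    proof (cases "y = 0")
      case True
      then show thesis using that[of 0] by simp
    next
      case False
      then have "S > 0"
        using S 3 by (auto simp: less_le S_def sum_nonneg_eq_0_iff vec_eq_iff)
      have "\<bar>x $ i\<bar> powr P = \<bar>y $ i\<bar> powr Q * (1 / S)" for i
      proof (cases "y $ i = 0")
        case False
        then have "\<bar>x $ i\<bar> = \<bar>y $ i\<bar> powr (Q - 1) * S powr (- 1 / P)"
          by (simp add: x_def abs_mult abs_sgn_eq)
        then show ?thesis
          using 3(1,2) \<open>S > 0\<close>
          by (simp add: powr_mult powr_divide powr_powr Q powr_minus inverse_eq_divide)
      qed (use 3 in \<open>auto simp: x_def\<close>)
      then have "(\<Sum>i\<in>UNIV. \<bar>x $ i\<bar> powr P) = S * (1 / S)"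
        unfolding S_def sum_distrib_right by simp
      then have "lp_norm p x \<le> 1"
        using 3 \<open>S > 0\<close> by (simp add: lp_norm_ennreal)
      moreover have "x \<bullet> y = lp_norm q y"
      proof -
        have "x $ i * y $ i = \<bar>y $ i\<bar> powr Q * S powr (- 1 / P)" for i
        proof (cases "y $ i = 0")
          case False
          have "x $ i * y $ i = \<bar>y $ i\<bar> powr (Q - 1) * (y $ i * sgn (y $ i)) * S powr (- 1 / P)"
            by (simp add: x_def mult_ac)
          also have "y $ i * sgn (y $ i) = \<bar>y $ i\<bar> powr 1"
            by (metis abs_sgn powr_one abs_ge_zero)
          finally show ?thesis
            unfolding powr_add[symmetric] by simp
        qed (use 3 in auto)
        then have "x \<bullet> y = S * S powr (- 1 / P)"
          by (simp add: inner_vec_def S_def sum_distrib_right)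
        also have "\<dots> = S powr (1 + (- 1 / P))"
          using \<open>S > 0\<close> by (subst powr_add) simp
        also have "1 + (- 1 / P) = 1 / Q"
          using 3 by simp
        finally show ?thesis
          using 3 by (simp add: lp_norm_ennreal S_def)
      qed
      ultimately show thesis by (rule that)
    qed
  qed
qed

text \<open>A maximiser for \<open>x + y\<close> is a linear functional dominated by
  \<open>lp_norm q\<close>, and its additivity gives Minkowski's inequality, at the endpoint
  exponents too.\<close>

lemma lp_norm_triangle:
  fixes x y :: "real^'n"
  assumes "1 / p + 1 / q = 1"
  shows "lp_norm q (x + y) \<le> lp_norm q x + lp_norm q y"
proof -
  obtain z where z: "lp_norm p z \<le> 1" "z \<bullet> (x + y) = lp_norm q (x + y)"
    using lp_norm_attained[OF assms] by blast
  have "z \<bullet> v \<le> lp_norm q v" for v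
    using lp_norm_Holder[OF assms, of z v] mult_right_mono[OF z(1) lp_norm_nonneg[of q v]] by simp
  from this[of x] this[of y] show ?thesis
    unfolding z(2)[symmetric] by (simp add: inner_add_right)
qed

text \<open>Polar form of the unit ball. It replaces the nonlinear constraint on a row vector by
  linear inequalities in a direction \<open>v\<close>, which can be compared with difference
  quotients.\<close>

lemma lp_norm_le_1_iff:
  fixes x :: "real^'n"
  assumes "1 / p + 1 / q = 1"
  shows "lp_norm p x \<le> 1 \<longleftrightarrow> (\<forall>v. x \<bullet> v \<le> lp_norm q v)"
proof
  assume x: "lp_norm p x \<le> 1"
  show "\<forall>v. x \<bullet> v \<le> lp_norm q v"
  proof
    fix v
    show "x \<bullet> v \<le> lp_norm q v"
      using lp_norm_Holder[OF assms, of x v] mult_right_mono[OF x lp_norm_nonneg[of q v]] by simp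
  qed
next
  assume *: "\<forall>v. x \<bullet> v \<le> lp_norm q v"
  have "1 / q + 1 / p = 1"
    using assms by (simp add: add.commute)
  then obtain v where "lp_norm q v \<le> 1" "v \<bullet> x = lp_norm p x"
    by (rule lp_norm_attained)
  with * show "lp_norm p x \<le> 1"
    by (metis inner_commute order_trans)
qed

section \<open>From the almost sure Jacobian constraint to a Lipschitz condition\<close>

lemma inner_has_derivative_le:
  fixes g :: "'w::real_normed_vector \<Rightarrow> 'r::real_inner"
  assumes "(g has_derivative D) (at w)"
    and "\<And>t. t > 0 \<Longrightarrow> \<zeta> \<bullet> (g (w + t *\<^sub>R v) - g w) \<le> t * C"
  shows "\<zeta> \<bullet> D v \<le> C"
proof -
  interpret D: bounded_linear D
    using assms(1) by (rule has_derivative_bounded_linear)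
  have "((\<lambda>t::real. w + t *\<^sub>R v) has_derivative (\<lambda>t. t *\<^sub>R v)) (at 0)"
    by (auto intro!: derivative_eq_intros)
  then have "((\<lambda>t::real. g (w + t *\<^sub>R v)) has_derivative (\<lambda>t. D (t *\<^sub>R v))) (at 0)"
    by (rule has_derivative_compose) (use assms(1) in simp)
  then have "((\<lambda>t::real. \<zeta> \<bullet> g (w + t *\<^sub>R v)) has_derivative (\<lambda>t. \<zeta> \<bullet> D (t *\<^sub>R v))) (at 0)"
    by (rule has_derivative_inner_right)
  then have "((\<lambda>t::real. \<zeta> \<bullet> g (w + t *\<^sub>R v)) has_real_derivative \<zeta> \<bullet> D v) (at 0)"
    by (simp add: has_field_derivative_def D.scaleR mult_commute_abs)
  \<comment> \<open>Right-hand difference quotients suffice, as the bound is available for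
    \<open>t > 0\<close> only. The later choices are \<open>C = lp_norm q v\<close> for the
    Lipschitz condition and \<open>C = 0\<close> for directions in which nothing varies.\<close>
  then have "((\<lambda>t. (\<zeta> \<bullet> g (w + t *\<^sub>R v) - \<zeta> \<bullet> g w) / t) \<longlongrightarrow> \<zeta> \<bullet> D v) (at_right 0)"
    by (simp add: has_field_derivative_iff filterlim_at_split)
  moreover have "\<forall>\<^sub>F t in at_right 0. (\<zeta> \<bullet> g (w + t *\<^sub>R v) - \<zeta> \<bullet> g w) / t \<le> C"
    using eventually_at_right_less[of "0::real"]
  proof eventually_elim
    case (elim t)
    then show ?case
      using assms(2)[of t] by (simp add: inner_diff_right divide_le_eq mult.commute)
  qed
  ultimately show ?thesis
    by (rule tendsto_upperbound) simp
qed

text \<open>Forwards, the mean value theorem on the segment from \<open>a\<close> to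
  \<open>b\<close>; backwards, difference quotients in the direction \<open>v\<close>, where
  homogeneity of the norm supplies the factor \<open>t\<close>.\<close>

lemma lp_norm_derivative_le_1_iff:
  fixes g :: "real^'m \<Rightarrow> real^'r"
  assumes "1 / p + 1 / q = 1"
    and deriv: "\<And>w. (g has_derivative (\<lambda>v. Dg w *v v)) (at w)"
  shows "(\<forall>w. lp_norm p (\<zeta> v* Dg w) \<le> 1) \<longleftrightarrow> (\<forall>a b. \<zeta> \<bullet> (g b - g a) \<le> lp_norm q (b - a))"
    (is "?L \<longleftrightarrow> ?R")
proof
  assume L: ?L
  show ?R
  proof (intro allI)
    fix a b
    have seg: "((\<lambda>t::real. \<zeta> \<bullet> g (a + t *\<^sub>R (b - a))) has_real_derivative
        \<zeta> \<bullet> (Dg (a + t *\<^sub>R (b - a)) *v (b - a))) (at t)" for t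
    proof -
      have "((\<lambda>t::real. a + t *\<^sub>R (b - a)) has_derivative (\<lambda>t. t *\<^sub>R (b - a))) (at t)"
        by (auto intro!: derivative_eq_intros)
      then have "((\<lambda>t::real. g (a + t *\<^sub>R (b - a))) has_derivative
          (\<lambda>s. Dg (a + t *\<^sub>R (b - a)) *v (s *\<^sub>R (b - a)))) (at t)"
        by (rule has_derivative_compose) (rule deriv)
      then have "((\<lambda>t::real. \<zeta> \<bullet> g (a + t *\<^sub>R (b - a))) has_derivative
          (\<lambda>s. \<zeta> \<bullet> (Dg (a + t *\<^sub>R (b - a)) *v (s *\<^sub>R (b - a))))) (at t)"
        by (rule has_derivative_inner_right)
      then show ?thesis
        by (simp add: has_field_derivative_def matrix_vector_mult_scaleR mult_commute_abs)
    qed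
    obtain t where "\<zeta> \<bullet> g (a + 1 *\<^sub>R (b - a)) - \<zeta> \<bullet> g (a + 0 *\<^sub>R (b - a)) =
        (1 - 0) * (\<zeta> \<bullet> (Dg (a + t *\<^sub>R (b - a)) *v (b - a)))"
      using MVT2[of 0 1 "\<lambda>t. \<zeta> \<bullet> g (a + t *\<^sub>R (b - a))", OF _ seg] by auto
    then have "\<zeta> \<bullet> (g b - g a) = (\<zeta> v* Dg (a + t *\<^sub>R (b - a))) \<bullet> (b - a)"
      by (simp add: inner_diff_right dot_lmul_matrix matrix_vector_mult_diff_distrib)
    also have "\<dots> \<le> lp_norm q (b - a)"
      using L lp_norm_le_1_iff[OF assms(1)] by blast
    finally show "\<zeta> \<bullet> (g b - g a) \<le> lp_norm q (b - a)" .
  qed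
next
  assume R: ?R
  have q: "q \<ge> 1"
    using assms(1) conjugate_exponent_ge_1[of q p] by (simp add: add.commute)
  show ?L
  proof
    fix w
    have "(\<zeta> v* Dg w) \<bullet> v \<le> lp_norm q v" for v
      unfolding dot_lmul_matrix
    proof (rule inner_has_derivative_le[OF deriv])
      fix t :: real assume "t > 0"
      then show "\<zeta> \<bullet> (g (w + t *\<^sub>R v) - g w) \<le> t * lp_norm q v"
        using R[rule_format, of "w + t *\<^sub>R v" w] by (simp add: lp_norm_scaleR q)
    qed
    then show "lp_norm p (\<zeta> v* Dg w) \<le> 1"
      using lp_norm_le_1_iff[OF assms(1)] by blast
  qed
qed

text \<open>A nonempty open set is not Lebesgue negligible, and an almost everywhere positive
  density cannot integrate to zero over such a set.\<close>

lemma (in prob_space) prob_open_pos: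
  fixes W :: "'a \<Rightarrow> 'w::euclidean_space"
  assumes "distributed M lborel W f" "AE w in lborel. f w > 0" "open G" "G \<noteq> {}"
  shows "\<P>(\<omega> in M. W \<omega> \<in> G) > 0"
proof -
  have [measurable]: "f \<in> borel_measurable borel" "G \<in> sets borel"
    using distributed_borel_measurable[OF assms(1)] assms(3) by auto
  have "emeasure M (W -` G \<inter> space M) = (\<integral>\<^sup>+w. f w * indicator G w \<partial>lborel)"
    using assms by (intro distributed_emeasure) auto
  moreover have "(\<integral>\<^sup>+w. f w * indicator G w \<partial>lborel) \<noteq> 0"
  proof
    assume "(\<integral>\<^sup>+w. f w * indicator G w \<partial>lborel) = 0"
    then have "AE w in lborel. f w * indicator G w = 0"
      by (subst (asm) nn_integral_0_iff_AE) auto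
    with assms(2) have "AE w in lborel. w \<notin> G"
      by eventually_elim (auto simp: indicator_def split: if_splits)
    then have "G \<in> null_sets lborel"
      by (simp add: AE_iff_null_sets)
    then have "negligible G"
      by (simp add: negligible_iff_null_sets null_sets_completionI)
    with assms(3,4) show False
      using open_not_negligible by blast
  qed
  ultimately have "emeasure M (W -` G \<inter> space M) \<noteq> 0" by simp
  then show ?thesis
    by (simp add: emeasure_eq_measure vimage_def Int_def conj_commute less_le)
qed

text \<open>By continuity of \<open>Dg\<close> the points that violate the gradient bound form an
  open set, which has probability zero only if it is empty.\<close>

lemma (in prob_space) almost_sure_lipschitz_dual:
  fixes W :: "'a \<Rightarrow> real^'m" and g :: "real^'m \<Rightarrow> real^'r"
  assumes pq: "1 / p + 1 / q = 1"
    and deriv: "\<And>w. (g has_derivative (\<lambda>v. Dg w *v v)) (at w)" "continuous_on UNIV Dg"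
    and density: "distributed M lborel W f" "AE w in lborel. f w > 0"
  shows "\<P>(\<omega> in M. lp_norm p (\<zeta> v* Dg (W \<omega>)) > 1) = 0 \<longleftrightarrow>
    (\<forall>a b. \<zeta> \<bullet> (g b - g a) \<le> lp_norm q (b - a))"
proof -
  let ?G = "{w. 1 < lp_norm p (\<zeta> v* Dg w)}"
  have "continuous_on UNIV (\<lambda>w. \<zeta> v* Dg w)"
    unfolding vector_matrix_mult_def
    by (intro continuous_intros continuous_on_vec_lambda continuous_on_component deriv(2))
  then have "continuous_on UNIV (\<lambda>w. lp_norm p (\<zeta> v* Dg w))"
    by (rule continuous_on_compose2[OF continuous_on_lp_norm[OF conjugate_exponent_ge_1[OF pq]]]) auto
  then have "open ?G"
    by (intro open_Collect_less) auto
  then have "\<P>(\<omega> in M. lp_norm p (\<zeta> v* Dg (W \<omega>)) > 1) = 0 \<longleftrightarrow> ?G = {}"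
    using prob_open_pos[OF density, of ?G] by force
  also have "\<dots> \<longleftrightarrow> (\<forall>a b. \<zeta> \<bullet> (g b - g a) \<le> lp_norm q (b - a))"
    unfolding lp_norm_derivative_le_1_iff[OF pq deriv(1), symmetric] by (auto simp: not_less)
  finally show ?thesis .
qed

section \<open>The dual constraint set\<close>

text \<open>Differences instead of derivatives: up to the final theorem the argument then involves
  only a continuous metric \<open>c\<close> and a continuous \<open>g\<close>. For the norm cost
  this is the set \<open>K\<close> of the theorem.\<close>

definition lipschitz_dual :: "('w \<Rightarrow> 'w \<Rightarrow> real) \<Rightarrow> ('w \<Rightarrow> 'r::euclidean_space) \<Rightarrow> 'r set" where
  "lipschitz_dual c g = {\<zeta>. \<forall>a b. \<zeta> \<bullet> (g b - g a) \<le> c a b}"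

lemma lipschitz_dualD: "\<zeta> \<in> lipschitz_dual c g \<Longrightarrow> \<zeta> \<bullet> (g b - g a) \<le> c a b"
  by (simp add: lipschitz_dual_def)

locale continuous_metric =
  fixes c :: "'w::euclidean_space \<Rightarrow> 'w \<Rightarrow> real"
  assumes cost_refl [simp]: "c x x = 0"
    and cost_pos: "x \<noteq> y \<Longrightarrow> 0 < c x y"
    and cost_sym: "c x y = c y x"
    and cost_triangle: "c x z \<le> c x y + c y z"
    and cost_continuous: "continuous_on UNIV (\<lambda>z. c (fst z) (snd z))"
begin

lemma cost_nonneg [simp]: "0 \<le> c x y"
  using cost_pos[of x y] by (cases "x = y") auto

lemma continuous_on_cost [continuous_intros]:
  assumes "continuous_on S u" "continuous_on S v"
  shows "continuous_on S (\<lambda>x. c (u x) (v x))"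
  using continuous_on_compose2[OF cost_continuous continuous_on_Pair[OF assms]] by simp

lemma zero_in_lipschitz_dual: "0 \<in> lipschitz_dual c g"
  by (simp add: lipschitz_dual_def)

text \<open>Reconciles two signs: the lower bound tests the mean of \<open>g\<close>, whereas the
  transport of mass has to produce the negative of that mean.\<close>

lemma uminus_lipschitz_dual: "\<zeta> \<in> lipschitz_dual c g \<Longrightarrow> - \<zeta> \<in> lipschitz_dual c g"
  unfolding lipschitz_dual_def mem_Collect_eq by (metis inner_minus_left inner_minus_right minus_diff_eq cost_sym)

text \<open>If the set were unbounded, normalised members would accumulate at a unit vector
  \<open>l\<close>. Dividing the constraints by the diverging norms leaves
  \<open>l \<bullet> (g b - g a) \<le> 0\<close> for all pairs, and exchanging \<open>a\<close> and
  \<open>b\<close> gives equality, contrary to the assumption.\<close>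

lemma compact_lipschitz_dual:
  fixes g :: "'w \<Rightarrow> 'r::euclidean_space"
  assumes "\<And>\<zeta>. \<zeta> \<noteq> 0 \<Longrightarrow> \<exists>a b. \<zeta> \<bullet> (g b - g a) \<noteq> 0"
  shows "compact (lipschitz_dual c g)"
proof -
  have "lipschitz_dual c g = (\<Inter>a. \<Inter>b. {\<zeta>. \<zeta> \<bullet> (g b - g a) \<le> c a b})"
    by (auto simp: lipschitz_dual_def)
  moreover have "closed \<dots>"
    by (intro closed_INT ballI closed_Collect_le continuous_intros)
  moreover have "bounded (lipschitz_dual c g)"
  proof (rule ccontr)
    assume "\<not> bounded (lipschitz_dual c g)"
    then have "\<exists>\<zeta>\<in>lipschitz_dual c g. norm \<zeta> > real k" for k :: nat
      by (meson bounded_iff not_less)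
    then obtain z where z: "\<And>k. z k \<in> lipschitz_dual c g" "\<And>k. norm (z k) > real k"
      by metis
    have nz: "norm (z k) > 0" for k
      using z(2)[of k] by (meson le_less_trans of_nat_0_le_iff)
    define u where "u k = z k /\<^sub>R norm (z k)" for k
    have "\<forall>k. u k \<in> sphere 0 1"
      using nz by (simp add: u_def)
    then obtain l r where l: "l \<in> sphere 0 1" "strict_mono r" "(u \<circ> r) \<longlonglongrightarrow> l"
      using compact_sphere[of "0::'r" 1] unfolding compact_def by blast
    have le: "l \<bullet> (g b - g a) \<le> 0" for a b
    proof (rule tendsto_le)
      show "(\<lambda>k. (u \<circ> r) k \<bullet> (g b - g a)) \<longlonglongrightarrow> l \<bullet> (g b - g a)"
        by (intro tendsto_intros l)
      show "(\<lambda>k. c a b / real (r k)) \<longlonglongrightarrow> 0"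
        using filterlim_compose[OF filterlim_real_sequentially filterlim_subseq[OF l(2)]]
        by (intro tendsto_divide_0[OF tendsto_const] filterlim_at_top_imp_at_infinity)
      show "\<forall>\<^sub>F k in sequentially. (u \<circ> r) k \<bullet> (g b - g a) \<le> c a b / real (r k)"
        using eventually_gt_at_top[of 0]
      proof eventually_elim
        case (elim k)
        then have "r k > 0"
          using seq_suble[OF l(2), of k] by simp
        have "(u \<circ> r) k \<bullet> (g b - g a) \<le> c a b / norm (z (r k))"
          using lipschitz_dualD[OF z(1), of "r k" b a] nz[of "r k"]
          by (simp add: u_def divide_right_mono inverse_eq_divide divide_simps mult.commute)
        also have "\<dots> \<le> c a b / real (r k)"
          using z(2)[of "r k"] nz[of "r k"] \<open>r k > 0\<close>
            by (intro divide_left_mono mult_pos_pos) auto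
        finally show ?case .
      qed
    qed simp
    have "l \<noteq> 0" using l(1) by auto
    then obtain a b where "l \<bullet> (g b - g a) \<noteq> 0" using assms by blast
    with le[of b a] le[of a b] show False
      by (simp add: inner_diff_right)
  qed
  ultimately show ?thesis
    by (simp add: compact_eq_bounded_closed)
qed

text \<open>The points far from the dual set form an unbounded region, so compactness is applied to
  the level set \<open>Z\<close> at distance exactly \<epsilon>. A farther point is scaled towards
  0, which lies in the dual set, until it meets \<open>Z\<close>; a strict violation found there
  survives scaling back, which only enlarges a positive inner product.\<close>

lemma finite_strict_cover:
  fixes g :: "'w \<Rightarrow> 'r::euclidean_space"
  assumes K: "compact (lipschitz_dual c g)" and g: "continuous_on UNIV g" and "\<epsilon> > 0"
  obtains J :: "('w set \<times> 'w) set" and \<kappa> where "finite J" "\<kappa> > 0"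
    "\<And>A b. (A, b) \<in> J \<Longrightarrow> open A \<and> A \<noteq> {}"
    "\<And>A b a. (A, b) \<in> J \<Longrightarrow> a \<in> A \<Longrightarrow> \<kappa> \<le> c a b"
    "\<And>\<zeta>. infdist \<zeta> (lipschitz_dual c g) \<ge> \<epsilon> \<Longrightarrow>
      \<exists>(A, b)\<in>J. \<forall>a\<in>A. c a b < \<zeta> \<bullet> (g b - g a)"
proof -
  let ?K = "lipschitz_dual c g"
  define Z where "Z = {\<zeta>. infdist \<zeta> ?K = \<epsilon>}"
  have K0: "?K \<noteq> {}"
    using zero_in_lipschitz_dual by blast
  have "closed Z"
    unfolding Z_def by (intro closed_Collect_eq continuous_intros)
  moreover have "bounded Z"
  proof -
    obtain B where B: "\<And>k. k \<in> ?K \<Longrightarrow> norm k \<le> B"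
      using compact_imp_bounded[OF K] by (auto simp: bounded_iff)
    have "norm \<zeta> \<le> B + \<epsilon>" if "\<zeta> \<in> Z" for \<zeta>
    proof -
      obtain k where k: "k \<in> ?K" "infdist \<zeta> ?K = dist \<zeta> k"
        using infdist_attains_inf[OF compact_imp_closed[OF K] K0] by blast
      then have "norm (\<zeta> - k) = \<epsilon>"
        using that by (simp add: Z_def dist_norm)
      with B[OF k(1)] norm_triangle_sub[of \<zeta> k] show ?thesis by simp
    qed
    then show ?thesis by (auto simp: bounded_iff)
  qed
  ultimately have "compact Z"
    by (simp add: compact_eq_bounded_closed)
  have "\<exists>V A b \<kappa>. open V \<and> open A \<and> \<zeta> \<in> V \<and> A \<noteq> {} \<and> \<kappa> > 0 \<and> (\<forall>a\<in>A. \<kappa> \<le> c a b) \<and>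
      (\<forall>\<xi>\<in>V. \<forall>a\<in>A. c a b < \<xi> \<bullet> (g b - g a))" if "\<zeta> \<in> Z" for \<zeta>
  proof -
    have "\<zeta> \<notin> ?K"
      using that \<open>\<epsilon> > 0\<close> by (auto simp: Z_def)
    then obtain a b where ab: "c a b < \<zeta> \<bullet> (g b - g a)"
      by (auto simp: lipschitz_dual_def not_le)
    then have "c a b > 0"
      by (cases "a = b") (auto intro: cost_pos)
    let ?U = "{x. c (snd x) b < fst x \<bullet> (g b - g (snd x))}"
    have "open ?U"
      by (intro open_Collect_less continuous_intros continuous_on_compose2[OF g]) auto
    moreover have "(\<zeta>, a) \<in> ?U"
      using ab by simp
    ultimately obtain V A where VA: "open V" "open A" "(\<zeta>, a) \<in> V \<times> A" "V \<times> A \<subseteq> ?U"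
      by (rule open_prod_elim)
    \<comment> \<open>Shrinking \<open>A\<close> keeps its points away from \<open>b\<close>. The
      resulting lower bound on the cost later limits the mass that a given budget can move.\<close>
    let ?A = "A \<inter> {x. c a b / 2 < c x b}"
    have "open ?A"
      by (intro open_Int VA open_Collect_less continuous_intros)
    moreover have "a \<in> ?A"
      using VA(3) \<open>c a b > 0\<close> by simp
    moreover have "\<forall>\<xi>\<in>V. \<forall>x\<in>?A. c x b < \<xi> \<bullet> (g b - g x)"
      using VA(4) by auto
    moreover have "\<forall>x\<in>?A. c a b / 2 \<le> c x b"
      by auto
    ultimately show ?thesis
      using VA \<open>c a b > 0\<close>
      by (intro exI[of _ V] exI[of _ ?A] exI[of _ b] exI[of _ "c a b / 2"]) auto
  qed
  then obtain V A b k where *: "\<And>\<zeta>. \<zeta> \<in> Z \<Longrightarrow> open (V \<zeta>) \<and> open (A \<zeta>) \<and> \<zeta> \<in> V \<zeta> \<and> A \<zeta> \<noteq> {} \<and>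
      k \<zeta> > (0::real) \<and> (\<forall>a\<in>A \<zeta>. k \<zeta> \<le> c a (b \<zeta>)) \<and>
      (\<forall>\<xi>\<in>V \<zeta>. \<forall>a\<in>A \<zeta>. c a (b \<zeta>) < \<xi> \<bullet> (g (b \<zeta>) - g a))"
    by metis
  obtain D where D: "D \<subseteq> Z" "finite D" "Z \<subseteq> (\<Union>\<zeta>\<in>D. V \<zeta>)"
    using compactE_image[OF \<open>compact Z\<close>, of Z V] * by blast
  \<comment> \<open>The inserted 1 covers an empty \<open>D\<close>.\<close>
  define \<kappa> where "\<kappa> = Min (insert 1 (k ` D))"
  show thesis
  proof (rule that[of "(\<lambda>\<zeta>. (A \<zeta>, b \<zeta>)) ` D" \<kappa>])
    show "\<kappa> > 0"
      using D * by (auto simp: \<kappa>_def)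
    show "\<kappa> \<le> c x y" if By: "(B, y) \<in> (\<lambda>\<zeta>. (A \<zeta>, b \<zeta>)) ` D" and x: "x \<in> B" for B x y
    proof -
      obtain \<zeta> where \<zeta>: "\<zeta> \<in> D" "B = A \<zeta>" "y = b \<zeta>"
        using By by auto
      then have "\<kappa> \<le> k \<zeta>"
        unfolding \<kappa>_def using D by (intro Min_le) auto
      then show ?thesis
        using \<zeta> x D * by force
    qed
    show "\<exists>(B, y)\<in>(\<lambda>\<zeta>. (A \<zeta>, b \<zeta>)) ` D. \<forall>x\<in>B. c x y < \<zeta> \<bullet> (g y - g x)"
      if \<zeta>: "infdist \<zeta> ?K \<ge> \<epsilon>" for \<zeta>
    proof -
      have "\<exists>t\<ge>0. t \<le> 1 \<and> infdist (t *\<^sub>R \<zeta>) ?K = \<epsilon>"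
        using \<zeta> \<open>\<epsilon> > 0\<close> zero_in_lipschitz_dual[of g]
        by (intro IVT') (auto intro!: continuous_intros)
      then obtain t where t: "0 \<le> t" "t \<le> 1" "infdist (t *\<^sub>R \<zeta>) ?K = \<epsilon>"
        by blast
      then have "t \<noteq> 0"
        using \<open>\<epsilon> > 0\<close> zero_in_lipschitz_dual[of g] by (intro notI) simp
      obtain \<xi> where \<xi>: "\<xi> \<in> D" "t *\<^sub>R \<zeta> \<in> V \<xi>"
        using t(3) D(3) by (auto simp: Z_def)
      have "c a (b \<xi>) < \<zeta> \<bullet> (g (b \<xi>) - g a)" if "a \<in> A \<xi>" for a
      proof -
        have "c a (b \<xi>) < (t *\<^sub>R \<zeta>) \<bullet> (g (b \<xi>) - g a)"
          using *[of \<xi>] \<xi> D that by blast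
        then have "c a (b \<xi>) < t * (\<zeta> \<bullet> (g (b \<xi>) - g a))"
          by simp
        moreover from this have "0 < t * (\<zeta> \<bullet> (g (b \<xi>) - g a))"
          using cost_nonneg[of a "b \<xi>"] by linarith
        then have "0 < \<zeta> \<bullet> (g (b \<xi>) - g a)"
          using t(1) by (simp add: zero_less_mult_iff)
        then have "t * (\<zeta> \<bullet> (g (b \<xi>) - g a)) \<le> 1 * (\<zeta> \<bullet> (g (b \<xi>) - g a))"
          using t by (intro mult_right_mono) auto
        ultimately show ?thesis by simp
      qed
      with \<xi>(1) show ?thesis by blast
    qed
  qed (use D * in auto)
qed

end

section \<open>Couplings with an empirical measure\<close>

lemma nn_integral_empirical_measure:
  assumes "\<phi> \<in> borel_measurable borel"
  shows "(\<integral>\<^sup>+x. \<phi> x \<partial>empirical_measure n w) = (\<Sum>i<n. ennreal (1 / n) * \<phi> (w i))"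
  using assms
  by (simp add: empirical_measure_def nn_integral_distr uniform_count_measure_def
      nn_integral_point_measure_finite)

lemma
  fixes \<phi> :: "'w::topological_space \<Rightarrow> 'r::{banach, second_countable_topology}"
  assumes "\<phi> \<in> borel_measurable borel"
  shows integrable_empirical_measure: "integrable (empirical_measure n w) \<phi>"
    and integral_empirical_measure:
      "(\<integral>x. \<phi> x \<partial>empirical_measure n w) = (1 / n) *\<^sub>R (\<Sum>i<n. \<phi> (w i))"
  using assms
  by (simp_all add: empirical_measure_def integrable_distr_eq integral_distr uniform_count_measure_def
      integrable_point_measure_finite lebesgue_integral_point_measure_finite scaleR_sum_right)

lemma sets_empirical_measure [simp, measurable_cong]: "sets (empirical_measure n w) = sets borel"
  by (simp add: empirical_measure_def)

text \<open>For \<open>n = 0\<close> the empirical measure has total mass zero, so it cannot be a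
  marginal of a probability measure. This settles the degenerate case of measurability.\<close>

lemma couplings_0: "couplings P (empirical_measure 0 w) = {}"
proof -
  have "False" if "\<pi> \<in> couplings P (empirical_measure 0 w)" for \<pi>
  proof -
    from that interpret prob_space \<pi>
      by (simp add: couplings_def)
    have "snd \<in> measurable \<pi> borel"
      using that measurable_cong_sets[of \<pi> borel borel borel]
      by (auto simp: couplings_def intro!: borel_measurable_continuous_onI continuous_intros)
    then have "prob_space (empirical_measure 0 w)"
      using that prob_space_distr[of snd borel] by (simp add: couplings_def)
    then have "emeasure (empirical_measure 0 w) UNIV = 1"
      using prob_space.emeasure_space_1 by (fastforce simp: empirical_measure_def)
    then show False
      by (simp add: emeasure_empirical_measure)
  qed
  then show ?thesis by blast
qed

lemma coupling_measurable:
  fixes P :: "'w::topological_space measure"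
  assumes "\<pi> \<in> couplings P Q"
  shows "fst \<in> measurable \<pi> borel" "snd \<in> measurable \<pi> borel"
  using assms measurable_cong_sets[of \<pi> borel borel borel]
  by (auto simp: couplings_def intro!: borel_measurable_continuous_onI continuous_intros)

lemma measurable_pair_measure_countable2:
  assumes "countable B" and [measurable]: "\<And>y. y \<in> B \<Longrightarrow> (\<lambda>x. f (x, y)) \<in> measurable M K"
  shows "f \<in> measurable (M \<Otimes>\<^sub>M count_space B) K"
  using _ _ assms(1)
  by (rule measurable_compose_countable'[where f="\<lambda>a b. f (fst b, a)" and g=snd and I=B, simplified]) simp_all

text \<open>Truncated subtraction carries the finite constant across the infimum.\<close>

lemma le_INF_add_ennreal:
  fixes f :: "'i \<Rightarrow> ennreal"
  assumes "\<And>i. i \<in> I \<Longrightarrow> a \<le> f i + ennreal d"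
  shows "a \<le> (INF i\<in>I. f i) + ennreal d"
proof -
  have "a - ennreal d \<le> (INF i\<in>I. f i)"
    using assms by (intro INF_greatest) (simp add: ennreal_minus_le_iff add.commute)
  then show ?thesis
    by (simp add: ennreal_minus_le_iff add.commute)
qed

section \<open>Lower bound by weak duality, and measurability of the profile function\<close>

context continuous_metric
begin

lemma borel_measurable_cost [measurable]:
  "u \<in> borel_measurable M \<Longrightarrow> v \<in> borel_measurable M \<Longrightarrow> (\<lambda>x. c (u x) (v x)) \<in> borel_measurable M"
  using measurable_compose[OF borel_measurable_Pair borel_measurable_continuous_onI[OF cost_continuous]]
  by simp

text \<open>The first marginal contributes nothing because \<open>g\<close> has mean zero under
  \<open>P\<close>, so only the sample mean remains. The split on infinite cost makes the cost
  Bochner integrable in the nontrivial case.\<close>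

lemma lipschitz_dual_le_coupling_cost:
  fixes g :: "'w \<Rightarrow> 'r::euclidean_space"
  assumes \<zeta>: "\<zeta> \<in> lipschitz_dual c g" and \<pi>: "\<pi> \<in> couplings P (empirical_measure n w)"
    and g: "continuous_on UNIV g" "integrable P g" "(\<integral>u. g u \<partial>P) = 0"
  shows "ennreal (\<zeta> \<bullet> ((1 / n) *\<^sub>R (\<Sum>i<n. g (w i)))) \<le> (\<integral>\<^sup>+z. ennreal (c (fst z) (snd z)) \<partial>\<pi>)"
proof (cases "(\<integral>\<^sup>+z. ennreal (c (fst z) (snd z)) \<partial>\<pi>) = \<infinity>")
  case False
  note [measurable] = coupling_measurable[OF \<pi>] borel_measurable_continuous_onI[OF g(1)]
  have P: "P = distr \<pi> borel fst" and Q: "empirical_measure n w = distr \<pi> borel snd"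
    using \<pi> by (auto simp: couplings_def)
  have c: "integrable \<pi> (\<lambda>z. c (fst z) (snd z))"
    using False by (intro integrableI_nonneg) (auto simp: top.not_eq_extremum)
  have 1: "integrable \<pi> (\<lambda>z. g (fst z))" "(\<integral>z. g (fst z) \<partial>\<pi>) = 0"
    using g unfolding P by (simp_all add: integrable_distr_eq integral_distr)
  have 2: "integrable \<pi> (\<lambda>z. g (snd z))"
      "(\<integral>z. g (snd z) \<partial>\<pi>) = (1 / n) *\<^sub>R (\<Sum>i<n. g (w i))"
    using integrable_empirical_measure[of g n w] integral_empirical_measure[of g n w]
    unfolding Q by (simp_all add: integrable_distr_eq integral_distr)
  have "\<zeta> \<bullet> ((1 / n) *\<^sub>R (\<Sum>i<n. g (w i))) = (\<integral>z. \<zeta> \<bullet> (g (snd z) - g (fst z)) \<partial>\<pi>)"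
    using 1 2 by simp
  also have "\<dots> \<le> (\<integral>z. c (fst z) (snd z) \<partial>\<pi>)"
    using 1 2 c \<zeta> by (intro integral_mono) (auto dest: lipschitz_dualD)
  finally show ?thesis
    by (subst nn_integral_eq_integral[OF c]) (auto intro: ennreal_leI)
qed simp

lemma lipschitz_dual_le_profile_function:
  fixes h :: "'w \<Rightarrow> 'l \<Rightarrow> 'r::euclidean_space"
  assumes "\<zeta> \<in> lipschitz_dual c (\<lambda>u. h u \<theta>)" "continuous_on UNIV (\<lambda>u. h u \<theta>)"
  shows "ennreal (\<zeta> \<bullet> ((1 / n) *\<^sub>R (\<Sum>i<n. h (w i) \<theta>))) \<le> profile_function c h n w \<theta>"
  unfolding profile_function_def transport_cost_def
  using lipschitz_dual_le_coupling_cost[OF assms(1) _ assms(2)] by (auto intro!: INF_greatest)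

text \<open>If the atoms \<open>w i\<close> move to \<open>w' i\<close>, the mass that a coupling sends to \<open>v\<close> is redistributed
  evenly over the indices \<open>i\<close> with \<open>w i = v\<close>; repeated atoms may be torn apart.\<close>

lemma coupling_empirical_measure_move:
  fixes w w' :: "nat \<Rightarrow> 'w"
  assumes "n > 0" and \<pi>: "\<pi> \<in> couplings P (empirical_measure n w)"
  obtains \<pi>' where "\<pi>' \<in> couplings P (empirical_measure n w')"
    "(\<integral>\<^sup>+z. ennreal (c (fst z) (snd z)) \<partial>\<pi>') \<le>
      (\<integral>\<^sup>+z. ennreal (c (fst z) (snd z)) \<partial>\<pi>) + ennreal ((\<Sum>i<n. c (w i) (w' i)) / n)"
proof -
  note [measurable] = coupling_measurable[OF \<pi>]
  from \<pi> interpret prob_space \<pi>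
    by (simp add: couplings_def)
  have P: "P = distr \<pi> borel fst" and Q: "empirical_measure n w = distr \<pi> borel snd"
    using \<pi> by (auto simp: couplings_def)
  define k where "k v = card {i. i < n \<and> w i = v}" for v
  \<comment> \<open>Conditional law of an index given \<open>z\<close>: uniform on the
    \<open>k v\<close> indices whose atom is \<open>v = snd z\<close>. \<open>\<Lambda>\<close>
    below is the joint law of \<open>z\<close> and this index.\<close>
  define \<rho> where "\<rho> = (\<lambda>(z :: 'w \<times> 'w, i :: nat). ennreal (indicator {w i} (snd z) / k (w i)) :: ennreal)"
  let ?C = "count_space {..<n} :: nat measure"
  interpret C: sigma_finite_measure ?C
    by (rule sigma_finite_measure_count_space_finite) simp
  have [measurable]: "\<rho> \<in> borel_measurable (\<pi> \<Otimes>\<^sub>M ?C)"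
    unfolding \<rho>_def by (intro measurable_pair_measure_countable2) (simp_all, measurable)
  have \<rho>_i [measurable]: "(\<lambda>z. \<rho> (z, i)) \<in> borel_measurable \<pi>" for i
    unfolding \<rho>_def by simp
  have k: "k (w i) > 0" if "i < n" for i
    using that by (auto simp: k_def card_gt_0_iff)
  define \<Lambda> where "\<Lambda> = density (\<pi> \<Otimes>\<^sub>M ?C) \<rho>"
  have [measurable_cong]: "sets \<Lambda> = sets (\<pi> \<Otimes>\<^sub>M ?C)"
    by (simp add: \<Lambda>_def)
  have \<Lambda>: "(\<integral>\<^sup>+x. \<phi> x \<partial>\<Lambda>) = (\<integral>\<^sup>+z. (\<Sum>i<n. \<rho> (z, i) * \<phi> (z, i)) \<partial>\<pi>)"
    if [measurable]: "\<phi> \<in> borel_measurable (\<pi> \<Otimes>\<^sub>M ?C)" for \<phi>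
    unfolding \<Lambda>_def
    by (simp add: nn_integral_density C.nn_integral_fst[symmetric] nn_integral_count_space_finite)
  \<comment> \<open>The coupling charges only the finitely many atoms, and over each atom the equal
    weights add up to one. Hence the first marginal will be preserved.\<close>
  have sum_\<rho>: "AE z in \<pi>. (\<Sum>i<n. \<rho> (z, i)) = 1"
  proof -
    have "closed (w ` {..<n})"
      by (simp add: finite_imp_closed)
    then have "emeasure (empirical_measure n w) (- w ` {..<n}) = 0"
      by (subst emeasure_empirical_measure) auto
    then have "AE v in empirical_measure n w. v \<in> w ` {..<n}"
      using \<open>closed (w ` {..<n})\<close> 
      by (intro AE_I[of _ _ "- w ` {..<n}"]) auto
    then have "AE z in \<pi>. snd z \<in> w ` {..<n}"
      unfolding Q by (rule AE_distrD[rotated]) measurable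
    then show ?thesis
    proof eventually_elim
      case (elim z)
      then obtain j where j: "j < n" "snd z = w j" by auto
      have "(\<Sum>i<n. \<rho> (z, i)) = (\<Sum>i\<in>{i. i < n \<and> w i = snd z}. ennreal (1 / k (snd z)))"
        unfolding \<rho>_def
        by (intro sum.mono_neutral_cong_right) (auto simp: indicator_def split: if_splits)
      also have "\<dots> = of_nat (k (snd z)) * ennreal (1 / k (snd z))"
        by (simp add: k_def)
      also have "\<dots> = ennreal (real (k (snd z)) * (1 / k (snd z)))"
        by (subst ennreal_mult) (auto simp: ennreal_of_nat_eq_real_of_nat)
      also have "real (k (snd z)) * (1 / k (snd z)) = 1"
        using k[OF j(1)] j(2) by simp
      also have "ennreal 1 = 1"
        by simp
      finally show ?case .
    qed
  qed
  \<comment> \<open>The atom has mass \<open>k (w i) / n\<close>, so the weight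
    \<open>1 / k (w i)\<close> leaves \<open>1 / n\<close> to each index, as the second marginal of
    \<open>\<pi>'\<close> requires.\<close>
  have int_\<rho>: "(\<integral>\<^sup>+z. \<rho> (z, i) \<partial>\<pi>) = ennreal (1 / n)" if "i < n" for i
  proof -
    have "(\<integral>\<^sup>+z. \<rho> (z, i) \<partial>\<pi>) = (\<integral>\<^sup>+v. ennreal (1 / k (w i)) * indicator {w i} v \<partial>empirical_measure n w)"
      unfolding Q by (auto simp: nn_integral_distr \<rho>_def indicator_def intro!: nn_integral_cong)
    also have "\<dots> = ennreal (1 / k (w i)) * ennreal (k (w i) / n)"
      by (simp add: nn_integral_cmult_indicator emeasure_empirical_measure k_def)
    also have "\<dots> = ennreal (1 / n)"
      using k[OF that] by (simp flip: ennreal_mult')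
    finally show ?thesis .
  qed
  define \<pi>' where "\<pi>' = distr \<Lambda> borel (\<lambda>(z, i). (fst z, w' i))"
  have T [measurable]: "(\<lambda>(z, i). (fst z, w' i)) \<in> measurable (\<pi> \<Otimes>\<^sub>M ?C) borel"
    by (intro measurable_pair_measure_countable2) (auto intro!: borel_measurable_Pair)
  have \<pi>': "(\<integral>\<^sup>+x. \<phi> x \<partial>\<pi>') = (\<integral>\<^sup>+z. (\<Sum>i<n. \<rho> (z, i) * \<phi> (fst z, w' i)) \<partial>\<pi>)"
    if [measurable]: "\<phi> \<in> borel_measurable borel" for \<phi>
    unfolding \<pi>'_def by (subst nn_integral_distr, measurable) (simp add: \<Lambda>)
  have [measurable_cong]: "sets \<pi>' = sets borel"
    by (simp add: \<pi>'_def)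
  have [measurable]: "fst \<in> measurable (borel :: ('w \<times> 'w) measure) borel"
      "snd \<in> measurable (borel :: ('w \<times> 'w) measure) borel"
    by (auto intro!: borel_measurable_continuous_onI continuous_intros)
  have "(\<integral>\<^sup>+z. (\<Sum>i<n. \<rho> (z, i)) \<partial>\<pi>) = (\<integral>\<^sup>+z. 1 \<partial>\<pi>)"
    using sum_\<rho> by (rule nn_integral_cong_AE)
  then have "prob_space \<pi>'"
    using \<pi>'[of "\<lambda>_. 1"] by (intro prob_spaceI) (simp add: emeasure_space_1)
  moreover have "distr \<pi>' borel fst = P"
  proof (rule measure_eqI)
    fix B assume "B \<in> sets (distr \<pi>' borel fst)"
    then have [measurable]: "B \<in> sets borel" by simp
    have "emeasure (distr \<pi>' borel fst) B = (\<integral>\<^sup>+x. indicator B (fst x) \<partial>\<pi>')"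
      by (simp add: nn_integral_distr flip: nn_integral_indicator)
    also have "\<dots> = (\<integral>\<^sup>+z. (\<Sum>i<n. \<rho> (z, i)) * indicator B (fst z) \<partial>\<pi>)"
      by (subst \<pi>') (auto simp: sum_distrib_right)
    also have "\<dots> = (\<integral>\<^sup>+z. indicator B (fst z) \<partial>\<pi>)"
      using sum_\<rho> by (intro nn_integral_cong_AE) auto
    also have "\<dots> = emeasure P B"
      unfolding P by (simp add: nn_integral_distr flip: nn_integral_indicator)
    finally show "emeasure (distr \<pi>' borel fst) B = emeasure P B" .
  qed (simp add: P)
  moreover have "distr \<pi>' borel snd = empirical_measure n w'"
  proof (rule measure_eqI)
    fix B assume "B \<in> sets (distr \<pi>' borel snd)"
    then have [measurable]: "B \<in> sets borel" by simp
    have "emeasure (distr \<pi>' borel snd) B = (\<integral>\<^sup>+x. indicator B (snd x) \<partial>\<pi>')"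
      by (simp add: nn_integral_distr flip: nn_integral_indicator)
    also have "\<dots> = (\<Sum>i<n. ennreal (1 / n) * indicator B (w' i))"
    proof -
      have "(\<integral>\<^sup>+x. indicator B (snd x) \<partial>\<pi>') = (\<integral>\<^sup>+z. (\<Sum>i<n. \<rho> (z, i) * indicator B (w' i)) \<partial>\<pi>)"
        by (subst \<pi>') auto
      also have "\<dots> = (\<Sum>i<n. \<integral>\<^sup>+z. \<rho> (z, i) * indicator B (w' i) \<partial>\<pi>)"
        by (intro nn_integral_sum borel_measurable_times_ennreal \<rho>_i) auto
      also have "\<dots> = (\<Sum>i<n. ennreal (1 / n) * indicator B (w' i))"
        by (intro sum.cong refl) (simp add: nn_integral_multc int_\<rho>)
      finally show ?thesis .
    qed
    also have "\<dots> = (\<integral>\<^sup>+x. indicator B x \<partial>empirical_measure n w')"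
      by (simp add: nn_integral_empirical_measure del: nn_integral_indicator)
    finally show "emeasure (distr \<pi>' borel snd) B = emeasure (empirical_measure n w') B"
      by simp
  qed simp
  ultimately have "\<pi>' \<in> couplings P (empirical_measure n w')"
    by (simp add: couplings_def \<pi>'_def)
  moreover have "(\<integral>\<^sup>+z. ennreal (c (fst z) (snd z)) \<partial>\<pi>') \<le>
      (\<integral>\<^sup>+z. ennreal (c (fst z) (snd z)) \<partial>\<pi>) + ennreal ((\<Sum>i<n. c (w i) (w' i)) / n)"
  proof -
    have "(\<integral>\<^sup>+z. ennreal (c (fst z) (snd z)) \<partial>\<pi>') =
        (\<integral>\<^sup>+z. (\<Sum>i<n. \<rho> (z, i) * ennreal (c (fst z) (w' i))) \<partial>\<pi>)"
      by (subst \<pi>') auto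
    also have "\<dots> \<le> (\<integral>\<^sup>+z. (\<Sum>i<n. \<rho> (z, i)) * ennreal (c (fst z) (snd z)) +
        (\<Sum>i<n. \<rho> (z, i) * ennreal (c (w i) (w' i))) \<partial>\<pi>)"
    proof (rule nn_integral_mono)
      fix z
      \<comment> \<open>The weight vanishes unless \<open>snd z = w i\<close>; in that case the
        triangle inequality runs through \<open>w i\<close>.\<close>
      have "\<rho> (z, i) * ennreal (c (fst z) (w' i)) \<le>
          \<rho> (z, i) * ennreal (c (fst z) (snd z)) + \<rho> (z, i) * ennreal (c (w i) (w' i))" for i
      proof (cases "snd z = w i")
        case True
        then have "ennreal (c (fst z) (w' i)) \<le> ennreal (c (fst z) (snd z)) + ennreal (c (w i) (w' i))"
          using cost_triangle[of "fst z" "w' i" "w i"] by (simp flip: ennreal_plus)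
        then show ?thesis
          by (simp add: mult_left_mono flip: distrib_left)
      qed (simp add: \<rho>_def)
      then show "(\<Sum>i<n. \<rho> (z, i) * ennreal (c (fst z) (w' i))) \<le>
          (\<Sum>i<n. \<rho> (z, i)) * ennreal (c (fst z) (snd z)) + (\<Sum>i<n. \<rho> (z, i) * ennreal (c (w i) (w' i)))"
        unfolding sum_distrib_right sum.distrib[symmetric] by (intro sum_mono)
    qed
    also have "\<dots> = (\<integral>\<^sup>+z. (\<Sum>i<n. \<rho> (z, i)) * ennreal (c (fst z) (snd z)) \<partial>\<pi>) +
        (\<Sum>i<n. (\<integral>\<^sup>+z. \<rho> (z, i) \<partial>\<pi>) * ennreal (c (w i) (w' i)))"
      by (subst nn_integral_add, measurable) (auto simp: nn_integral_sum nn_integral_multc)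
    also have "(\<integral>\<^sup>+z. (\<Sum>i<n. \<rho> (z, i)) * ennreal (c (fst z) (snd z)) \<partial>\<pi>) =
        (\<integral>\<^sup>+z. ennreal (c (fst z) (snd z)) \<partial>\<pi>)"
      using sum_\<rho> by (intro nn_integral_cong_AE) auto
    also have "(\<Sum>i<n. (\<integral>\<^sup>+z. \<rho> (z, i) \<partial>\<pi>) * ennreal (c (w i) (w' i))) =
        ennreal ((\<Sum>i<n. c (w i) (w' i)) / n)"
      by (simp add: int_\<rho> sum_divide_distrib sum_ennreal flip: ennreal_mult')
    finally show ?thesis .
  qed
  ultimately show thesis by (rule that)
qed

text \<open>The additional cost depends neither on \<open>P\<close> nor on the coupling, so the
  bound passes through both infima.\<close>

lemma profile_function_move:
  fixes h :: "'w \<Rightarrow> 'l \<Rightarrow> 'r::euclidean_space"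
  assumes "n > 0"
  shows "profile_function c h n w' \<theta> \<le>
    profile_function c h n w \<theta> + ennreal ((\<Sum>i<n. c (w i) (w' i)) / n)"
proof -
  let ?d = "ennreal ((\<Sum>i<n. c (w i) (w' i)) / n)"
  have "transport_cost c P (empirical_measure n w') \<le> transport_cost c P (empirical_measure n w) + ?d" for P
    unfolding transport_cost_def[of c P "empirical_measure n w"]
  proof (rule le_INF_add_ennreal)
    fix \<pi> assume "\<pi> \<in> couplings P (empirical_measure n w)"
    from coupling_empirical_measure_move[OF assms this, of w']
    show "transport_cost c P (empirical_measure n w') \<le>
        (\<integral>\<^sup>+z. ennreal (c (fst z) (snd z)) \<partial>\<pi>) + ?d"
      unfolding transport_cost_def by (metis (no_types, lifting) INF_lower2)
  qed
  then show ?thesis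
    unfolding profile_function_def
    by (intro le_INF_add_ennreal) (meson INF_lower order_trans)
qed

text \<open>The infimum ranges over uncountably many measures, so measurability is obtained from the
  topology: strict sublevel sets are open, because the bound of \<open>profile_function_move\<close>
  is continuous in \<open>w'\<close> and agrees with the profile at \<open>w' = w\<close>.\<close>

lemma borel_measurable_profile_function:
  fixes h :: "'w \<Rightarrow> 'l \<Rightarrow> 'r::euclidean_space"
  shows "(\<lambda>w. profile_function c h n w \<theta>) \<in> borel_measurable borel"
proof (cases "n = 0")
  case True
  then show ?thesis
    by (simp add: profile_function_def transport_cost_def couplings_0)
next
  case False
  show ?thesis
  proof (rule borel_measurableI_less)
    fix y :: ennreal
    have "open {w. profile_function c h n w \<theta> < y}"
      unfolding open_subopen[of "{w. profile_function c h n w \<theta> < y}"]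
    proof safe
      fix w assume w: "profile_function c h n w \<theta> < y"
      let ?G = "{w'. profile_function c h n w \<theta> + ennreal ((\<Sum>i<n. c (w i) (w' i)) / n) < y}"
      have "open ?G"
        by (intro open_Collect_less continuous_intros continuous_on_ennreal continuous_on_product_coordinates)
            (use False in auto)
      moreover have "w \<in> ?G"
        using w by simp
      moreover have "?G \<subseteq> {w. profile_function c h n w \<theta> < y}"
        using profile_function_move[of n h _ \<theta> w] False by (auto intro: le_less_trans)
      ultimately show "\<exists>G. open G \<and> w \<in> G \<and> G \<subseteq> {w. profile_function c h n w \<theta> < y}"
        by blast
    qed
    then show "{w \<in> space borel. profile_function c h n w \<theta> < y} \<in> sets borel"
      by simp
  qed
qed

end

section \<open>Upper bound by explicit couplings\<close>

lemma sum_option_pairs: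
  fixes \<phi> :: "nat \<times> 'j option \<Rightarrow> 'c::comm_monoid_add"
  assumes "finite J"
  shows "(\<Sum>x\<in>{..<n} \<times> insert None (Some ` J). \<phi> x) =
    (\<Sum>i<n. \<phi> (i, None) + (\<Sum>j\<in>J. \<phi> (i, Some j)))"
  using assms by (simp add: sum.cartesian_product' sum.reindex)

lemma convex_hull_insert_0_imageE:
  fixes p :: "'j \<Rightarrow> 'r::real_vector"
  assumes "finite J" "y \<in> convex hull (insert 0 (p ` J))"
  obtains u where "\<And>j. j \<in> J \<Longrightarrow> 0 \<le> u j" "(\<Sum>j\<in>J. u j) \<le> 1" "y = (\<Sum>j\<in>J. u j *\<^sub>R p j)"
proof -
  let ?S = "{\<Sum>j\<in>J. u j *\<^sub>R p j |u. (\<forall>j\<in>J. 0 \<le> u j) \<and> (\<Sum>j\<in>J. u j) \<le> (1::real)}"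
  have "convex hull (insert 0 (p ` J)) \<subseteq> ?S"
  proof (rule hull_minimal)
    show "insert 0 (p ` J) \<subseteq> ?S"
    proof (intro subsetI)
      fix z assume "z \<in> insert 0 (p ` J)"
      then consider "z = 0" | k where "k \<in> J" "z = p k" by auto
      then show "z \<in> ?S"
      proof cases
        case 1
        then show ?thesis by (auto intro!: exI[of _ "\<lambda>_. 0"])
      next
        case 2
        with assms(1) show ?thesis
          by (auto intro!: exI[of _ "\<lambda>j. if j = k then 1 else 0"] simp: if_distrib[of "\<lambda>x. x *\<^sub>R _"] cong: if_cong)
      qed
    qed
    show "convex ?S"
    proof (rule convexI)
      fix x y :: 'r and s t :: real
      assume st: "0 \<le> s" "0 \<le> t" "s + t = 1" and "x \<in> ?S" "y \<in> ?S"
      then obtain u v where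
        u: "\<forall>j\<in>J. 0 \<le> u j" "(\<Sum>j\<in>J. u j) \<le> 1" "x = (\<Sum>j\<in>J. u j *\<^sub>R p j)" and
        v: "\<forall>j\<in>J. 0 \<le> v j" "(\<Sum>j\<in>J. v j) \<le> 1" "y = (\<Sum>j\<in>J. v j *\<^sub>R p j)"
        by blast
      have "s * (\<Sum>j\<in>J. u j) + t * (\<Sum>j\<in>J. v j) \<le> 1"
        using u v st by (intro convex_bound_le) auto
      then show "s *\<^sub>R x + t *\<^sub>R y \<in> ?S"
        using u v st
        by (auto intro!: exI[of _ "\<lambda>j. s * u j + t * v j"]
            simp: sum.distrib sum_distrib_left scaleR_sum_right scaleR_add_left)
    qed
  qed
  with assms(2) that show thesis by blast
qed

context continuous_metric
begin

text \<open>The coupling lives on labels: \<open>(i, None)\<close> carries the mass that stays at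
  \<open>w i\<close>, and \<open>(i, Some j)\<close> the mass \<open>r i j\<close> sent from
  \<open>w i\<close> to \<open>b j\<close>. The bound on the row sums keeps the remaining mass
  nonnegative.\<close>

lemma profile_function_le_split:
  fixes h :: "'w \<Rightarrow> 'l \<Rightarrow> 'r::euclidean_space" and r :: "nat \<Rightarrow> 'j \<Rightarrow> real"
  assumes "n > 0" and J: "finite J"
    and r: "\<And>i j. i < n \<Longrightarrow> j \<in> J \<Longrightarrow> 0 \<le> r i j" "\<And>i. i < n \<Longrightarrow> (\<Sum>j\<in>J. r i j) \<le> 1 / n"
    and g: "continuous_on UNIV (\<lambda>u. h u \<theta>)"
    and 0: "(1 / n) *\<^sub>R (\<Sum>i<n. h (w i) \<theta>) +
      (\<Sum>i<n. \<Sum>j\<in>J. r i j *\<^sub>R (h (b j) \<theta> - h (w i) \<theta>)) = 0"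
  shows "profile_function c h n w \<theta> \<le> ennreal (\<Sum>i<n. \<Sum>j\<in>J. r i j * c (b j) (w i))"
proof -
  define X where "X = {..<n} \<times> insert None (Some ` J)"
  define m where "m x = (case snd x of None \<Rightarrow> 1 / n - (\<Sum>j\<in>J. r (fst x) j) | Some j \<Rightarrow> r (fst x) j)" for x
  define T where "T x = (case snd x of None \<Rightarrow> w (fst x) | Some j \<Rightarrow> b j, w (fst x))" for x
  define \<mu> where "\<mu> = point_measure X (\<lambda>x. ennreal (m x))"
  define \<pi> where "\<pi> = distr \<mu> borel T"
  define P where "P = distr \<pi> borel fst"
  have X: "finite X"
    using J by (simp add: X_def)
  have m: "m x \<ge> 0" if "x \<in> X" for x
    using that r by (auto simp: X_def m_def)
  note sum_X = sum_option_pairs[OF J, of _ n, folded X_def]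
  have m_X: "(\<Sum>j\<in>insert None (Some ` J). m (i, j)) = 1 / n" for i
    using J by (simp add: m_def sum.reindex)
  have fst_snd: "fst \<in> borel_measurable (borel :: ('w \<times> 'w) measure)"
      "snd \<in> borel_measurable (borel :: ('w \<times> 'w) measure)"
    by (auto intro!: borel_measurable_continuous_onI continuous_intros)
  have T [measurable]: "T \<in> borel_measurable \<mu>"
    by (simp add: \<mu>_def)
  have [measurable_cong]: "sets \<pi> = sets borel"
    by (simp add: \<pi>_def)
  note [measurable] = fst_snd borel_measurable_continuous_onI[OF g]
  have nn: "(\<integral>\<^sup>+z. \<phi> z \<partial>\<pi>) = (\<Sum>x\<in>X. ennreal (m x) * \<phi> (T x))"
    if "\<phi> \<in> borel_measurable borel" for \<phi>
    using that X by (simp add: \<pi>_def nn_integral_distr \<mu>_def nn_integral_point_measure_finite)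
  have "prob_space \<pi>"
  proof (rule prob_spaceI)
    have "emeasure \<pi> (space \<pi>) = (\<Sum>x\<in>X. ennreal (m x))"
      using nn[of "\<lambda>_. 1"] by simp
    also have "\<dots> = ennreal (\<Sum>x\<in>X. m x)"
      using m by (simp add: sum_ennreal)
    also have "(\<Sum>x\<in>X. m x) = 1"
      using \<open>n > 0\<close> by (simp add: X_def sum.cartesian_product' m_X del: sum.insert)
    finally show "emeasure \<pi> (space \<pi>) = 1" by simp
  qed
  then interpret \<pi>: prob_space \<pi> .
  have "distr \<pi> borel snd = empirical_measure n w"
  proof (rule measure_eqI)
    fix B assume "B \<in> sets (distr \<pi> borel snd)"
    then have [measurable]: "B \<in> sets borel" by simp
    have "emeasure (distr \<pi> borel snd) B = (\<integral>\<^sup>+z. indicator B (snd z) \<partial>\<pi>)"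
      by (simp add: nn_integral_distr flip: nn_integral_indicator)
    also have "\<dots> = (\<Sum>x\<in>X. ennreal (m x) * indicator B (w (fst x)))"
      by (subst nn) (auto simp: T_def)
    also have "\<dots> = (\<Sum>i<n. \<Sum>j\<in>insert None (Some ` J). ennreal (m (i, j)) * indicator B (w i))"
      by (simp add: X_def sum.cartesian_product' del: sum.insert)
    also have "\<dots> = (\<Sum>i<n. ennreal (1 / n) * indicator B (w i))"
    proof (intro sum.cong refl)
      fix i assume "i \<in> {..<n}"
      then have "(\<Sum>j\<in>insert None (Some ` J). ennreal (m (i, j))) = ennreal (1 / n)"
        using m by (subst sum_ennreal) (auto simp: X_def m_X simp del: sum.insert)
      then show "(\<Sum>j\<in>insert None (Some ` J). ennreal (m (i, j)) * indicator B (w i)) =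
          ennreal (1 / n) * indicator B (w i)"
        by (simp flip: sum_distrib_right del: sum.insert)
    qed
    also have "\<dots> = (\<integral>\<^sup>+x. indicator B x \<partial>empirical_measure n w)"
      by (simp add: nn_integral_empirical_measure del: nn_integral_indicator)
    finally show "emeasure (distr \<pi> borel snd) B = emeasure (empirical_measure n w) B"
      by simp
  qed simp
  then have \<pi>: "\<pi> \<in> couplings P (empirical_measure n w)"
    using \<open>prob_space \<pi>\<close> by (simp add: couplings_def P_def \<pi>_def)
  have "(\<lambda>x. h (fst (T x)) \<theta>) \<in> borel_measurable \<mu>"
    by measurable
  then have "integrable \<mu> (\<lambda>x. h (fst (T x)) \<theta>)"
    using X m by (simp add: \<mu>_def integrable_point_measure_finite)
  then have int: "integrable P (\<lambda>u. h u \<theta>)"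
    by (simp add: P_def \<pi>_def integrable_distr_eq)
  have "(\<integral>u. h u \<theta> \<partial>P) = (\<Sum>x\<in>X. m x *\<^sub>R h (fst (T x)) \<theta>)"
    using X m by (simp add: P_def \<pi>_def integral_distr \<mu>_def lebesgue_integral_point_measure_finite)
  also have "\<dots> = (1 / n) *\<^sub>R (\<Sum>i<n. h (w i) \<theta>) +
      (\<Sum>i<n. \<Sum>j\<in>J. r i j *\<^sub>R (h (b j) \<theta> - h (w i) \<theta>))"
    unfolding sum_X
    by (simp add: m_def T_def scaleR_diff_left scaleR_diff_right sum_subtractf sum.distrib
        scaleR_sum_left scaleR_sum_right algebra_simps)
  finally have mean: "(\<integral>u. h u \<theta> \<partial>P) = 0"
    using 0 by simp
  have "profile_function c h n w \<theta> \<le> transport_cost c P (empirical_measure n w)"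
    unfolding profile_function_def
    using int mean \<pi>.prob_space_distr[of fst borel] by (intro INF_lower) (simp add: P_def)
  also have "\<dots> \<le> (\<integral>\<^sup>+z. ennreal (c (fst z) (snd z)) \<partial>\<pi>)"
    unfolding transport_cost_def using \<pi> by (rule INF_lower)
  also have "\<dots> = (\<Sum>x\<in>X. ennreal (m x) * ennreal (c (fst (T x)) (snd (T x))))"
    by (subst nn) auto
  also have "\<dots> = ennreal (\<Sum>x\<in>X. m x * c (fst (T x)) (snd (T x)))"
    using m by (subst sum_ennreal[symmetric]) (auto simp: ennreal_mult)
  also have "(\<Sum>x\<in>X. m x * c (fst (T x)) (snd (T x))) = (\<Sum>i<n. \<Sum>j\<in>J. r i j * c (b j) (w i))"
    unfolding sum_X by (simp add: m_def T_def)
  finally show ?thesis .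
qed

text \<open>The target \<open>- x\<close> of the required displacement is a combination of the average displacements
  \<open>D\<close> because no hyperplane separates \<open>- x / \<tau>\<close> from the hull of \<open>0\<close> and the \<open>D / C\<close>.\<close>

lemma profile_function_le:
  fixes h :: "'w \<Rightarrow> 'l \<Rightarrow> 'r::euclidean_space" and \<theta> :: 'l and \<beta> \<kappa> \<epsilon> s :: real
  defines "K \<equiv> lipschitz_dual c (\<lambda>u. h u \<theta>)"
  assumes "n > 0" "finite J" "\<epsilon> > 0" "\<kappa> > 0" "\<beta> > 0"
    and K: "compact K"
    and g: "continuous_on UNIV (\<lambda>u. h u \<theta>)"
    and lower: "\<And>A b a. (A, b) \<in> J \<Longrightarrow> a \<in> A \<Longrightarrow> \<kappa> \<le> c a b"
    and cover: "\<And>\<zeta>. infdist \<zeta> K \<ge> \<epsilon> \<Longrightarrow> \<exists>(A, b)\<in>J. \<forall>a\<in>A. c a b < \<zeta> \<bullet> (h b \<theta> - h a \<theta>)"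
    and many: "\<And>A b. (A, b) \<in> J \<Longrightarrow> \<beta> * n \<le> card {i. i < n \<and> w i \<in> A}"
    and x: "x = (1 / n) *\<^sub>R (\<Sum>i<n. h (w i) \<theta>)"
    and s: "\<And>\<zeta>. \<zeta> \<in> K \<Longrightarrow> \<zeta> \<bullet> x \<le> s"
    and small: "s + \<epsilon> * norm x \<le> \<kappa> * \<beta>"
  shows "profile_function c h n w \<theta> \<le> ennreal (s + \<epsilon> * norm x)"
proof -
  \<comment> \<open>\<open>\<tau>\<close> is the cost budget. When mass is moved evenly from the
    sample points in \<open>fst j\<close> to \<open>snd j\<close>, \<open>D j\<close> is the change
    of the mean and \<open>C j\<close> the cost, both per unit of mass.\<close>
  define \<tau> where "\<tau> = s + \<epsilon> * norm x"
  define I where "I j = {i. i < n \<and> w i \<in> fst j}" for j :: "'w set \<times> 'w"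
  define k where "k j = real (card (I j))" for j
  define D where "D j = (1 / k j) *\<^sub>R (\<Sum>i\<in>I j. h (snd j) \<theta> - h (w i) \<theta>)" for j
  define C where "C j = (1 / k j) * (\<Sum>i\<in>I j. c (w i) (snd j))" for j
  have K0: "0 \<in> K"
    unfolding K_def by (rule zero_in_lipschitz_dual)
  have "s \<ge> 0"
    using s[OF K0] by simp
  then have "\<tau> \<ge> 0"
    using \<open>\<epsilon> > 0\<close> by (simp add: \<tau>_def)
  have I: "finite (I j)" for j
    by (simp add: I_def)
  have k: "\<beta> * n \<le> k j" if "j \<in> J" for j
    using many[of "fst j" "snd j"] that by (simp add: k_def I_def)
  have kpos: "k j > 0" if "j \<in> J" for j
    using k[OF that] \<open>\<beta> > 0\<close> \<open>n > 0\<close> by (meson less_le_trans mult_pos_pos of_nat_0_less_iff)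
  have C: "\<kappa> \<le> C j" if "j \<in> J" for j
  proof -
    have "(\<Sum>i\<in>I j. \<kappa>) \<le> (\<Sum>i\<in>I j. c (w i) (snd j))"
      using lower[of "fst j" "snd j"] that by (intro sum_mono) (auto simp: I_def)
    then show ?thesis
      using kpos[OF that] by (simp add: C_def k_def divide_simps mult.commute)
  qed
  then have Cpos: "C j > 0" if "j \<in> J" for j
    using \<open>\<kappa> > 0\<close> that by (meson less_le_trans)
  \<comment> \<open>The strict inequality of the cover holds at every point of \<open>fst j\<close>,
    so it survives averaging over the sample points there.\<close>
  have sep: "\<exists>j\<in>J. C j < \<zeta> \<bullet> D j" if far: "infdist \<zeta> K \<ge> \<epsilon>" for \<zeta>
  proof -
    obtain j where j: "j \<in> J" "\<And>a. a \<in> fst j \<Longrightarrow> c a (snd j) < \<zeta> \<bullet> (h (snd j) \<theta> - h a \<theta>)"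
      using cover[OF far] by (auto simp: split_beta)
    have "I j \<noteq> {}"
      using kpos[OF j(1)] by (auto simp: k_def)
    then have "(\<Sum>i\<in>I j. c (w i) (snd j)) < (\<Sum>i\<in>I j. \<zeta> \<bullet> (h (snd j) \<theta> - h (w i) \<theta>))"
      using j(2) I by (intro sum_strict_mono) (auto simp: I_def)
    then have "C j < \<zeta> \<bullet> D j"
      using kpos[OF j(1)] by (simp add: C_def D_def divide_strict_right_mono flip: inner_sum_right)
    with j(1) show ?thesis by blast
  qed
  obtain u where u: "\<And>j. j \<in> J \<Longrightarrow> 0 \<le> u j" "(\<Sum>j\<in>J. u j) \<le> 1"
    "- x = (\<Sum>j\<in>J. (\<tau> * u j / C j) *\<^sub>R D j)"
  \<comment> \<open>The budget is known to be positive, so that it can be divided by, only for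
    \<open>x \<noteq> 0\<close>.\<close>
  proof (cases "x = 0")
    case True
    then show thesis using that[of "\<lambda>_. 0"] by simp
  next
    case False
    then have "\<tau> > 0"
      using \<open>\<epsilon> > 0\<close> \<open>s \<ge> 0\<close> by (simp add: \<tau>_def add_nonneg_pos)
    define y where "y = - x /\<^sub>R \<tau>"
    let ?S = "convex hull (insert 0 ((\<lambda>j. D j /\<^sub>R C j) ` J))"
    have "y \<in> ?S"
    proof (rule ccontr)
      assume "y \<notin> ?S"
      moreover have "closed ?S"
        using \<open>finite J\<close> by (intro compact_imp_closed finite_imp_compact_convex_hull) auto
      ultimately obtain a \<beta>' where a: "a \<bullet> y < \<beta>'" "\<And>z. z \<in> ?S \<Longrightarrow> a \<bullet> z > \<beta>'"
        using separating_hyperplane_closed_point[OF convex_convex_hull, of "insert 0 ((\<lambda>j. D j /\<^sub>R C j) ` J)" y]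
        by blast
      from a(2)[of 0] have "\<beta>' < 0"
        by (simp add: hull_inc)
      \<comment> \<open>Division by the negative \<open>\<beta>'\<close> puts the hyperplane at
        level 1 and reverses both inequalities. By \<open>sep\<close>, \<open>\<zeta>\<close> is
        then close to \<open>K\<close>; comparison with its nearest point \<open>z\<close>, whose
        negative also lies in \<open>K\<close>, contradicts
        \<open>\<zeta> \<bullet> y > 1\<close>.\<close>
      define \<zeta> where "\<zeta> = a /\<^sub>R \<beta>'"
      have "\<zeta> \<bullet> D j < C j" if "j \<in> J" for j
      proof -
        have "a \<bullet> (D j /\<^sub>R C j) > \<beta>'"
          using that by (intro a hull_inc) auto
        then show ?thesis
          using Cpos[OF that] \<open>\<beta>' < 0\<close> by (simp add: \<zeta>_def field_simps)
      qed
      then have "infdist \<zeta> K < \<epsilon>"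
        using sep[of \<zeta>] by (meson less_asym not_le)
      moreover obtain z where z: "z \<in> K" "infdist \<zeta> K = dist \<zeta> z"
        using infdist_attains_inf[OF compact_imp_closed[OF K]] K0 by blast
      ultimately have "norm (\<zeta> - z) \<le> \<epsilon>"
        by (simp add: dist_norm)
      have "\<zeta> \<bullet> (- x) = (- z) \<bullet> x + (\<zeta> - z) \<bullet> (- x)"
        by (simp add: inner_diff_left)
      also have "\<dots> \<le> s + norm (\<zeta> - z) * norm (- x)"
        using z(1) by (intro add_mono s norm_cauchy_schwarz) (simp add: K_def uminus_lipschitz_dual)
      also have "\<dots> \<le> \<tau>"
        using \<open>norm (\<zeta> - z) \<le> \<epsilon>\<close> by (simp add: \<tau>_def mult_right_mono)
      finally have "\<zeta> \<bullet> y \<le> 1"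
        using \<open>\<tau> > 0\<close> by (simp add: y_def field_simps)
      moreover have "\<zeta> \<bullet> y > 1"
        using a(1) \<open>\<beta>' < 0\<close> by (simp add: \<zeta>_def field_simps)
      ultimately show False by simp
    qed
    with \<open>finite J\<close> obtain u where u: "\<And>j. j \<in> J \<Longrightarrow> 0 \<le> u j" "(\<Sum>j\<in>J. u j) \<le> 1"
        "y = (\<Sum>j\<in>J. u j *\<^sub>R (D j /\<^sub>R C j))"
      by (rule convex_hull_insert_0_imageE) blast
    have "- x = \<tau> *\<^sub>R y"
      using \<open>\<tau> > 0\<close> by (simp add: y_def)
    also have "\<dots> = (\<Sum>j\<in>J. (\<tau> * u j / C j) *\<^sub>R D j)"
      by (simp add: u(3) scaleR_sum_right divide_inverse mult_ac)
    finally show thesis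
      using that[OF u(1,2)] by simp
  qed
  \<comment> \<open>The share \<open>\<tau> * u j\<close> of the budget, at unit cost
    \<open>C j\<close>, moves the mass \<open>\<tau> * u j / C j\<close>, spread evenly over the
    \<open>k j\<close> sample points in \<open>I j\<close>.\<close>
  define r where "r i j = (if i \<in> I j then \<tau> * u j / C j / k j else 0)" for i j
  have r0: "0 \<le> r i j" if "j \<in> J" for i j
    using that \<open>\<tau> \<ge> 0\<close> u(1) Cpos[OF that] kpos[OF that] by (simp add: r_def)
  have swap: "(\<Sum>i<n. \<Sum>j\<in>J. r i j *\<^sub>R \<phi> i j) = (\<Sum>j\<in>J. (\<tau> * u j / C j / k j) *\<^sub>R (\<Sum>i\<in>I j. \<phi> i j))"
    for \<phi> :: "nat \<Rightarrow> 'w set \<times> 'w \<Rightarrow> 'v::real_vector"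
  proof -
    have "(\<Sum>i<n. r i j *\<^sub>R \<phi> i j) = (\<Sum>i\<in>I j. (\<tau> * u j / C j / k j) *\<^sub>R \<phi> i j)" for j
      unfolding r_def by (intro sum.mono_neutral_cong_right) (auto simp: I_def)
    then show ?thesis
      by (subst sum.swap) (simp add: scaleR_sum_right)
  qed
  have "profile_function c h n w \<theta> \<le> ennreal (\<Sum>i<n. \<Sum>j\<in>J. r i j * c (snd j) (w i))"
  proof (rule profile_function_le_split[where h=h and \<theta>=\<theta> and n=n and J=J and r=r and b=snd])
    fix i assume "i < n"
    \<comment> \<open>No sample point gives away more than its mass \<open>1 / n\<close>: unit costs
      are at least \<open>\<kappa>\<close>, every \<open>I j\<close> has at least
      \<open>\<beta> * n\<close> elements, and \<open>small\<close> bounds the budget by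
      \<open>\<kappa> * \<beta>\<close>.\<close>
    have "(\<Sum>j\<in>J. r i j) \<le> (\<Sum>j\<in>J. \<tau> * u j / (\<kappa> * (\<beta> * n)))"
    proof (rule sum_mono)
      fix j assume j: "j \<in> J"
      have "r i j \<le> \<tau> * u j / (C j * k j)"
        using j \<open>\<tau> \<ge> 0\<close> u(1) Cpos[OF j] kpos[OF j] by (simp add: r_def)
      also have "\<dots> \<le> \<tau> * u j / (\<kappa> * (\<beta> * n))"
        using j \<open>\<tau> \<ge> 0\<close> u(1) C[OF j] k[OF j] \<open>\<kappa> > 0\<close> \<open>\<beta> > 0\<close> \<open>n > 0\<close> Cpos[OF j] kpos[OF j]
        by (intro divide_left_mono mult_mono mult_pos_pos mult_nonneg_nonneg) auto
      finally show "r i j \<le> \<tau> * u j / (\<kappa> * (\<beta> * n))" .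
    qed
    also have "\<dots> = \<tau> * (\<Sum>j\<in>J. u j) / (\<kappa> * (\<beta> * n))"
      by (simp add: sum_distrib_left sum_divide_distrib)
    also have "\<dots> \<le> (\<kappa> * \<beta>) * 1 / (\<kappa> * (\<beta> * n))"
      using small u \<open>\<kappa> > 0\<close> \<open>\<beta> > 0\<close> \<open>n > 0\<close> \<open>\<tau> \<ge> 0\<close>
      by (intro divide_right_mono mult_mono) (auto simp: \<tau>_def intro: sum_nonneg)
    also have "\<dots> = 1 / n"
      using \<open>\<kappa> > 0\<close> \<open>\<beta> > 0\<close> by simp
    finally show "(\<Sum>j\<in>J. r i j) \<le> 1 / n" .
  next
    have "(\<Sum>i<n. \<Sum>j\<in>J. r i j *\<^sub>R (h (snd j) \<theta> - h (w i) \<theta>)) = - x"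
      unfolding swap u(3) D_def by simp
    then show "(1 / n) *\<^sub>R (\<Sum>i<n. h (w i) \<theta>) +
        (\<Sum>i<n. \<Sum>j\<in>J. r i j *\<^sub>R (h (snd j) \<theta> - h (w i) \<theta>)) = 0"
      by (simp add: x)
  qed (use r0 \<open>n > 0\<close> \<open>finite J\<close> g in auto)
  also have "(\<Sum>i<n. \<Sum>j\<in>J. r i j * c (snd j) (w i)) = (\<Sum>j\<in>J. \<tau> * u j)"
  proof -
    have "(\<Sum>i<n. \<Sum>j\<in>J. r i j * c (snd j) (w i)) = (\<Sum>j\<in>J. (\<tau> * u j / C j / k j) * (\<Sum>i\<in>I j. c (snd j) (w i)))"
      using swap[of "\<lambda>i j. c (snd j) (w i)"] by simp
    also have "\<dots> = (\<Sum>j\<in>J. \<tau> * u j / C j * C j)"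
      by (intro sum.cong refl) (simp add: C_def cost_sym[of "snd _"])
    finally show ?thesis
      using Cpos by (simp add: less_imp_neq[THEN not_sym])
  qed
  also have "\<dots> \<le> ennreal \<tau>"
    using \<open>\<tau> \<ge> 0\<close> u(2) by (intro ennreal_leI) (simp add: mult_left_le flip: sum_distrib_left)
  finally show ?thesis
    by (simp add: \<tau>_def)
qed

end

section \<open>A multivariate central limit theorem\<close>

text \<open>Serves two replacements: a test function by a trigonometric polynomial, with
  \<open>G\<close> the event of a large argument, and the profile by the support function, with
  \<open>G\<close> also containing the failure of the upper bound.\<close>

lemma (in prob_space) abs_integral_diff_le:
  fixes u v :: "'a \<Rightarrow> real"
  assumes int: "integrable M u" "integrable M v" and G: "G \<in> events" "prob G \<le> e"
    and close: "\<And>\<omega>. \<omega> \<in> space M \<Longrightarrow> \<omega> \<notin> G \<Longrightarrow> \<bar>u \<omega> - v \<omega>\<bar> \<le> a"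
    and bound: "\<And>\<omega>. \<omega> \<in> space M \<Longrightarrow> \<bar>u \<omega> - v \<omega>\<bar> \<le> b" and "0 \<le> a"
  shows "\<bar>(\<integral>\<omega>. u \<omega> \<partial>M) - (\<integral>\<omega>. v \<omega> \<partial>M)\<bar> \<le> a + b * e"
proof -
  have "b \<ge> 0"
    using not_empty bound by (meson abs_ge_zero equals0I order_trans)
  have [simp]: "integrable M (indicator G :: 'a \<Rightarrow> real)"
    using G(1) by (simp add: integrable_real_indicator emeasure_eq_measure)
  have "\<bar>(\<integral>\<omega>. u \<omega> \<partial>M) - (\<integral>\<omega>. v \<omega> \<partial>M)\<bar> = \<bar>\<integral>\<omega>. u \<omega> - v \<omega> \<partial>M\<bar>"
    using int by simp
  also have "\<dots> \<le> (\<integral>\<omega>. \<bar>u \<omega> - v \<omega>\<bar> \<partial>M)"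
    by (rule integral_abs_bound)
  also have "\<dots> \<le> (\<integral>\<omega>. a + b * indicator G \<omega> \<partial>M)"
  proof (rule integral_mono)
    show "\<bar>u \<omega> - v \<omega>\<bar> \<le> a + b * indicator G \<omega>" if "\<omega> \<in> space M" for \<omega>
      using close[OF that] bound[OF that] \<open>0 \<le> a\<close> by (cases "\<omega> \<in> G") auto
  qed (use int G(1) in auto)
  also have "\<dots> = a + b * prob G"
    using G by (simp add: prob_space)
  finally show ?thesis
    using mult_left_mono[OF G(2) \<open>b \<ge> 0\<close>] by simp
qed

text \<open>Each generator depends on a single projection \<open>t \<bullet> x\<close>, and products
  are not among the rules, so convergence of expectations extends from projections by linearity
  alone. The closure under products that Stone-Weierstrass asks for is derived afterwards.\<close>

inductive trig_poly :: "('v::euclidean_space \<Rightarrow> real) \<Rightarrow> bool" where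
  cos: "trig_poly (\<lambda>x. cos (t \<bullet> x))"
| sin: "trig_poly (\<lambda>x. sin (t \<bullet> x))"
| add: "trig_poly f \<Longrightarrow> trig_poly g \<Longrightarrow> trig_poly (\<lambda>x. f x + g x)"
| scale: "trig_poly f \<Longrightarrow> trig_poly (\<lambda>x. a * f x)"

lemma trig_poly_const: "trig_poly (\<lambda>x. a)"
  using trig_poly.scale[OF trig_poly.cos[of 0], of a] by simp

lemma trig_poly_continuous: "trig_poly f \<Longrightarrow> continuous_on S f"
  by (induction rule: trig_poly.induct) (auto intro!: continuous_intros)

lemma trig_poly_bounded: "trig_poly f \<Longrightarrow> \<exists>B. \<forall>x. \<bar>f x\<bar> \<le> B"
proof (induction rule: trig_poly.induct)
  case (add f g)
  then obtain B C where "\<forall>x. \<bar>f x\<bar> \<le> B" "\<forall>x. \<bar>g x\<bar> \<le> C" by blast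
  then have "\<forall>x. \<bar>f x + g x\<bar> \<le> B + C"
    by (meson abs_triangle_ineq add_mono order_trans)
  then show ?case by blast
next
  case (scale f a)
  then obtain B where "\<forall>x. \<bar>f x\<bar> \<le> B" by blast
  then have "\<forall>x. \<bar>a * f x\<bar> \<le> \<bar>a\<bar> * B"
    by (simp add: abs_mult mult_left_mono)
  then show ?case by blast
qed (auto intro: exI[of _ 1])

text \<open>Product-to-sum formulas on the generators, extended linearly.\<close>

lemma trig_poly_mult_cos_sin:
  assumes "trig_poly f"
  shows "trig_poly (\<lambda>x. cos (t \<bullet> x) * f x) \<and> trig_poly (\<lambda>x. sin (t \<bullet> x) * f x)"
  using assms
proof (induction rule: trig_poly.induct)
  case (cos s)
  have "(\<lambda>x. cos (t \<bullet> x) * cos (s \<bullet> x)) = (\<lambda>x. (1/2) * cos ((t - s) \<bullet> x) + (1/2) * cos ((t + s) \<bullet> x))"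
    "(\<lambda>x. sin (t \<bullet> x) * cos (s \<bullet> x)) = (\<lambda>x. (1/2) * sin ((t - s) \<bullet> x) + (1/2) * sin ((t + s) \<bullet> x))"
    by (auto simp: inner_add_left inner_diff_left cos_add cos_diff sin_add sin_diff add_divide_distrib
        diff_divide_distrib)
  then show ?case
    by (simp only: simp_thms) (intro conjI trig_poly.intros)
next
  case (sin s)
  have "(\<lambda>x. cos (t \<bullet> x) * sin (s \<bullet> x)) = (\<lambda>x. (1/2) * sin ((t + s) \<bullet> x) + (-1/2) * sin ((t - s) \<bullet> x))"
    "(\<lambda>x. sin (t \<bullet> x) * sin (s \<bullet> x)) = (\<lambda>x. (1/2) * cos ((t - s) \<bullet> x) + (-1/2) * cos ((t + s) \<bullet> x))"
    by (auto simp: inner_add_left inner_diff_left cos_add cos_diff sin_add sin_diff add_divide_distrib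
        diff_divide_distrib)
  then show ?case
    by (simp only: simp_thms) (intro conjI trig_poly.intros)
next
  case (add f g)
  then show ?case by (simp add: distrib_left trig_poly.add)
next
  case (scale f a)
  then show ?case by (simp add: mult.left_commute trig_poly.scale)
qed

lemma trig_poly_mult:
  assumes "trig_poly f" "trig_poly g"
  shows "trig_poly (\<lambda>x. f x * g x)"
  using assms(1)
proof (induction rule: trig_poly.induct)
  case (add f f')
  then show ?case by (simp add: distrib_right trig_poly.add)
next
  case (scale f a)
  then show ?case by (simp add: mult.assoc trig_poly.scale)
qed (use trig_poly_mult_cos_sin[OF assms(2)] in auto)

lemma trig_poly_polynomial:
  fixes q :: "real \<Rightarrow> real"
  assumes "real_polynomial_function q" "trig_poly p"
  shows "trig_poly (\<lambda>x. q (p x))"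
  using assms(1)
proof (induction rule: real_polynomial_function.induct)
  case (linear q)
  then have "q y = q 1 * y" for y
    using linear_cmul[OF bounded_linear.linear, of q y 1] by simp
  then have "(\<lambda>x. q (p x)) = (\<lambda>x. q 1 * p x)"
    by (rule ext)
  with assms(2) show ?case
    by (simp add: trig_poly.scale)
qed (auto intro: trig_poly_const trig_poly.add trig_poly_mult)

text \<open>Scaling \<open>t\<close> to \<open>t \<bullet> (x - y) = 1\<close> makes the phase
  difference 1, which lies strictly between 0 and \<open>pi\<close>, where the cosine has dropped
  below \<open>cos 0\<close>.\<close>

lemma trig_poly_separates:
  fixes x y :: "'v::euclidean_space"
  assumes "x \<noteq> y"
  shows "\<exists>f. trig_poly f \<and> f x \<noteq> f y"
proof -
  define d where "d = x - y"
  have "d \<bullet> d > 0"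
    using assms by (simp add: d_def)
  define t where "t = (1 / (d \<bullet> d)) *\<^sub>R d"
  have "t \<bullet> d = 1"
    using \<open>d \<bullet> d > 0\<close> by (simp add: t_def)
  have "(1 - cos (t \<bullet> (x - x))) \<noteq> 1 - cos (t \<bullet> (x - y))"
    using \<open>t \<bullet> d = 1\<close> cos_monotone_0_pi[of 0 1] pi_ge_two by (simp flip: d_def)
  moreover have "trig_poly (\<lambda>z. 1 - cos (t \<bullet> (x - z)))"
  proof -
    have "(\<lambda>z. 1 - cos (t \<bullet> (x - z))) =
        (\<lambda>z. 1 + ((- cos (t \<bullet> x)) * cos (t \<bullet> z) + (- sin (t \<bullet> x)) * sin (t \<bullet> z)))"
      by (auto simp: inner_diff_right cos_diff)
    then show ?thesis
      by (simp only: trig_poly.intros trig_poly_const)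
  qed
  ultimately show ?thesis by blast
qed

text \<open>The approximating polynomial has no bound outside the ball until it is composed with a
  polynomial approximation of the clipping function.\<close>

lemma trig_poly_approx:
  fixes f :: "'v::euclidean_space \<Rightarrow> real"
  assumes f: "continuous_on UNIV f" "\<And>x. \<bar>f x\<bar> \<le> B" and "e > 0"
  obtains p where "trig_poly p" "\<And>x. norm x \<le> R \<Longrightarrow> \<bar>f x - p x\<bar> \<le> 2 * e" "\<And>x. \<bar>p x\<bar> \<le> B + e"
proof -
  have "\<exists>p. trig_poly p \<and> (\<forall>x\<in>cball 0 R. \<bar>f x - p x\<bar> < e)"
    by (rule Stone_Weierstrass_HOL)
      (use \<open>e > 0\<close> continuous_on_subset[OF f(1)] in \<open>auto intro: trig_poly_const trig_poly_continuous
        trig_poly.add trig_poly_mult trig_poly_separates\<close>)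
  then obtain p where p: "trig_poly p" "\<And>x. x \<in> cball 0 R \<Longrightarrow> \<bar>f x - p x\<bar> < e"
    by blast
  obtain L where L: "\<And>x. \<bar>p x\<bar> \<le> L"
    using trig_poly_bounded[OF p(1)] by blast
  define k where "k y = max (- B) (min B y)" for y :: real
  have "B \<ge> 0"
    using f(2)[of 0] by linarith
  have "continuous_on {-L..L} k"
    unfolding k_def by (intro continuous_intros)
  then obtain q where q: "real_polynomial_function q" "\<And>y. y \<in> {-L..L} \<Longrightarrow> \<bar>k y - q y\<bar> < e"
    using Stone_Weierstrass_real_polynomial_function[of "{-L..L}" k e] \<open>e > 0\<close> by blast
  have q': "\<bar>k (p x) - q (p x)\<bar> < e" for x
    using L[of x] by (intro q(2)) (auto simp: abs_le_iff)
  show thesis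
  proof (rule that[OF trig_poly_polynomial[OF q(1) p(1)]])
    fix x
    have "\<bar>k (p x)\<bar> \<le> B"
      using \<open>B \<ge> 0\<close> by (auto simp: k_def)
    with q'[of x] show "\<bar>q (p x)\<bar> \<le> B + e" by linarith
    assume "norm x \<le> R"
    then have "\<bar>f x - p x\<bar> < e"
      by (intro p(2)) simp
    \<comment> \<open>Clipping is nonexpansive and fixes the values of \<open>f\<close>, which lie
      between \<open>- B\<close> and \<open>B\<close>.\<close>
    moreover have "\<bar>f x - k (p x)\<bar> \<le> \<bar>f x - p x\<bar>"
      using f(2)[of x] by (auto simp: k_def max_def min_def)
    ultimately show "\<bar>f x - q (p x)\<bar> \<le> 2 * e"
      using q'[of x] by linarith
  qed
qed

lemma (in prob_space) norm_tight:
  fixes Y :: "'a \<Rightarrow> 'v::euclidean_space"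
  assumes [measurable]: "Y \<in> borel_measurable M" and "e > 0"
  obtains R where "\<P>(\<omega> in M. norm (Y \<omega>) > R) < e"
proof -
  let ?A = "\<lambda>k::nat. {\<omega>\<in>space M. norm (Y \<omega>) > real k}"
  have "(\<lambda>k. prob (?A k)) \<longlonglongrightarrow> prob (\<Inter>k. ?A k)"
    by (intro finite_Lim_measure_decseq) (auto simp: decseq_def)
  also have "(\<Inter>k. ?A k) = {}"
  proof -
    have "\<exists>k. \<not> norm (Y \<omega>) > real k" for \<omega>
      using real_arch_simple[of "norm (Y \<omega>)"] by (auto simp: not_less)
    then show ?thesis by blast
  qed
  finally have "\<forall>\<^sub>F k in sequentially. prob (?A k) < e"
    using \<open>e > 0\<close> by (intro order_tendstoD) auto
  then show thesis
    using that by (auto simp: eventually_sequentially)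
qed

text \<open>Inside a large ball the approximating trigonometric polynomial is uniformly close;
  outside, it is bounded independently of the radius, so the small probability given by tightness
  controls the error for all \<open>n\<close> at once.\<close>

lemma integral_tendsto_of_trig:
  fixes X :: "nat \<Rightarrow> 'a \<Rightarrow> 'v::euclidean_space"
  assumes M: "prob_space M" "\<And>n. X n \<in> borel_measurable M"
    and N: "prob_space N" "Y \<in> borel_measurable N"
    and cos: "\<And>t. (\<lambda>n. \<integral>\<omega>. cos (t \<bullet> X n \<omega>) \<partial>M) \<longlonglongrightarrow> (\<integral>\<omega>. cos (t \<bullet> Y \<omega>) \<partial>N)"
    and sin: "\<And>t. (\<lambda>n. \<integral>\<omega>. sin (t \<bullet> X n \<omega>) \<partial>M) \<longlonglongrightarrow> (\<integral>\<omega>. sin (t \<bullet> Y \<omega>) \<partial>N)"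
    and tight: "\<And>e. e > 0 \<Longrightarrow> \<exists>R. \<forall>n. \<P>(\<omega> in M. norm (X n \<omega>) > R) < e"
    and f: "continuous_on UNIV f" "bounded (range f)"
  shows "(\<lambda>n. \<integral>\<omega>. f (X n \<omega>) \<partial>M) \<longlonglongrightarrow> (\<integral>\<omega>. f (Y \<omega>) \<partial>N :: real)"
proof -
  interpret M: prob_space M by fact
  interpret N: prob_space N by fact
  note [measurable] = M(2) N(2)
  have intM: "integrable M (\<lambda>\<omega>. \<phi> (X n \<omega>))" and intN: "integrable N (\<lambda>\<omega>. \<phi> (Y \<omega>))"
    if \<phi>: "continuous_on UNIV \<phi>" "\<And>x. \<bar>\<phi> x\<bar> \<le> b" for \<phi> :: "'v \<Rightarrow> real" and n b
  proof -
    note [measurable] = borel_measurable_continuous_onI[OF \<phi>(1)]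
    show "integrable M (\<lambda>\<omega>. \<phi> (X n \<omega>))" "integrable N (\<lambda>\<omega>. \<phi> (Y \<omega>))"
      using \<phi>(2) by (auto intro!: M.integrable_const_bound[where B=b] N.integrable_const_bound[where B=b])
  qed
  have trig: "(\<lambda>n. \<integral>\<omega>. p (X n \<omega>) \<partial>M) \<longlonglongrightarrow> (\<integral>\<omega>. p (Y \<omega>) \<partial>N)" if "trig_poly p" for p
    using that
  proof (induction rule: trig_poly.induct)
    case (add f g)
    obtain B C where B: "\<And>x. \<bar>f x\<bar> \<le> B" and C: "\<And>x. \<bar>g x\<bar> \<le> C"
      using trig_poly_bounded[OF add.hyps(1)] trig_poly_bounded[OF add.hyps(2)] by blast
    have "integrable M (\<lambda>\<omega>. f (X n \<omega>))" "integrable N (\<lambda>\<omega>. f (Y \<omega>))"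
        "integrable M (\<lambda>\<omega>. g (X n \<omega>))" "integrable N (\<lambda>\<omega>. g (Y \<omega>))" for n
      using intM[OF trig_poly_continuous[OF add.hyps(1)] B] intN[OF trig_poly_continuous[OF add.hyps(1)] B]
        intM[OF trig_poly_continuous[OF add.hyps(2)] C] intN[OF trig_poly_continuous[OF add.hyps(2)] C]
      by auto
    then show ?case
      using add.IH by (simp add: tendsto_add)
  next
    case (scale f a)
    then show ?case by (simp add: tendsto_mult_left)
  qed (use cos sin in auto)
  obtain B where B: "\<And>x. \<bar>f x\<bar> \<le> B"
    using f(2) by (auto simp: bounded_iff)
  have "B \<ge> 0"
    using B[of 0] by linarith
  show ?thesis
  proof (rule LIMSEQ_I)
    fix \<eta> :: real assume "\<eta> > 0"
    \<comment> \<open>Each replacement costs at most \<open>2 * e + (2 * B + e) * e\<close>, hence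
      at most \<open>(2 * B + 3) * e\<close> for \<open>e \<le> 1\<close>. There are two
      replacements and one limit, each allotted a third of \<open>\<eta>\<close>.\<close>
    define e where "e = min 1 (\<eta> / (3 * (2 * B + 3)))"
    have e: "e > 0" "e \<le> 1" "(2 * B + 3) * e \<le> \<eta> / 3"
    proof -
      have "(2 * B + 3) * e \<le> (2 * B + 3) * (\<eta> / (3 * (2 * B + 3)))"
        using \<open>B \<ge> 0\<close> by (intro mult_left_mono) (auto simp: e_def)
      also have "\<dots> = \<eta> / 3"
        using \<open>B \<ge> 0\<close> by (simp add: divide_simps)
      finally show "(2 * B + 3) * e \<le> \<eta> / 3" .
    qed (use \<open>\<eta> > 0\<close> \<open>B \<ge> 0\<close> in \<open>auto simp: e_def\<close>)
    obtain R where R: "\<And>n. \<P>(\<omega> in M. norm (X n \<omega>) > R) < e"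
      using tight[OF \<open>e > 0\<close>] by blast
    obtain R' where R': "\<P>(\<omega> in N. norm (Y \<omega>) > R') < e"
      using N.norm_tight[OF N(2) \<open>e > 0\<close>] by blast
    obtain p where p: "trig_poly p" "\<And>x. norm x \<le> max R R' \<Longrightarrow> \<bar>f x - p x\<bar> \<le> 2 * e" "\<And>x. \<bar>p x\<bar> \<le> B + e"
      by (rule trig_poly_approx[OF f(1) B \<open>e > 0\<close>, of "max R R'"]) blast
    have b: "\<bar>f x - p x\<bar> \<le> 2 * B + e" for x
      using B[of x] p(3)[of x] by linarith
    have le: "2 * e + (2 * B + e) * e \<le> \<eta> / 3"
    proof -
      have "2 * e + (2 * B + e) * e \<le> 2 * e + (2 * B + 1) * e"
        using e by (intro add_left_mono mult_right_mono) auto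
      also have "\<dots> = (2 * B + 3) * e"
        by (simp add: algebra_simps)
      finally show ?thesis using e(3) by simp
    qed
    have dM: "\<bar>(\<integral>\<omega>. f (X n \<omega>) \<partial>M) - (\<integral>\<omega>. p (X n \<omega>) \<partial>M)\<bar> \<le> 2 * e + (2 * B + e) * e" for n
      using R[of n] b p(2) e(1)
      by (intro M.abs_integral_diff_le[where G="{\<omega>\<in>space M. norm (X n \<omega>) > R}"]
          intM[OF f(1) B] intM[OF trig_poly_continuous[OF p(1)] p(3)]) auto
    have dN: "\<bar>(\<integral>\<omega>. f (Y \<omega>) \<partial>N) - (\<integral>\<omega>. p (Y \<omega>) \<partial>N)\<bar> \<le> 2 * e + (2 * B + e) * e"
      using R' b p(2) e(1)
      by (intro N.abs_integral_diff_le[where G="{\<omega>\<in>space N. norm (Y \<omega>) > R'}"]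
          intN[OF f(1) B] intN[OF trig_poly_continuous[OF p(1)] p(3)]) auto
    obtain n0 where n0: "\<And>n. n \<ge> n0 \<Longrightarrow> norm ((\<integral>\<omega>. p (X n \<omega>) \<partial>M) - (\<integral>\<omega>. p (Y \<omega>) \<partial>N)) < \<eta> / 3"
      using LIMSEQ_D[OF trig[OF p(1)], of "\<eta> / 3"] \<open>\<eta> > 0\<close> by auto
    have "norm ((\<integral>\<omega>. f (X n \<omega>) \<partial>M) - (\<integral>\<omega>. f (Y \<omega>) \<partial>N)) < \<eta>" if "n \<ge> n0" for n
      using n0[OF that] dM[of n] dN le unfolding real_norm_def by linarith
    then show "\<exists>n0. \<forall>n\<ge>n0. norm ((\<integral>\<omega>. f (X n \<omega>) \<partial>M) - (\<integral>\<omega>. f (Y \<omega>) \<partial>N)) < \<eta>"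
      by blast
  qed
qed

section \<open>Moments and limits of sums of i.i.d. centred vectors\<close>

locale iid_centered = prob_space M for M :: "'a measure" +
  fixes X :: "nat \<Rightarrow> 'a \<Rightarrow> 'v::euclidean_space" and X0 :: "'a \<Rightarrow> 'v"
  assumes indep: "indep_vars (\<lambda>_. borel) X UNIV"
    and X0 [measurable]: "X0 \<in> borel_measurable M"
    and same_distr: "\<And>i. distr M borel (X i) = distr M borel X0"
    and square_integrable: "integrable M (\<lambda>\<omega>. (norm (X0 \<omega>))\<^sup>2)"
    and mean_0: "(\<integral>\<omega>. X0 \<omega> \<partial>M) = 0"
begin

lemma rv [measurable]: "X i \<in> borel_measurable M"
  using indep by (auto simp: indep_vars_def)

lemma
  fixes \<phi> :: "'v \<Rightarrow> 'c::{banach, second_countable_topology}"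
  assumes [measurable]: "\<phi> \<in> borel_measurable borel"
  shows integrable_iff_X0: "integrable M (\<lambda>\<omega>. \<phi> (X i \<omega>)) \<longleftrightarrow> integrable M (\<lambda>\<omega>. \<phi> (X0 \<omega>))"
    and integral_eq_X0: "(\<integral>\<omega>. \<phi> (X i \<omega>) \<partial>M) = (\<integral>\<omega>. \<phi> (X0 \<omega>) \<partial>M)"
proof -
  show "integrable M (\<lambda>\<omega>. \<phi> (X i \<omega>)) \<longleftrightarrow> integrable M (\<lambda>\<omega>. \<phi> (X0 \<omega>))"
    using integrable_distr_eq[of "X i" M borel \<phi>] integrable_distr_eq[of X0 M borel \<phi>] same_distr[of i]
    by simp
  show "(\<integral>\<omega>. \<phi> (X i \<omega>) \<partial>M) = (\<integral>\<omega>. \<phi> (X0 \<omega>) \<partial>M)"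
    using integral_distr[of "X i" M borel \<phi>] integral_distr[of X0 M borel \<phi>] same_distr[of i] by simp
qed

lemma integrable_X0: "integrable M X0"
proof -
  have "integrable M (\<lambda>\<omega>. norm (X0 \<omega>))"
    using square_integrable_imp_integrable[of "\<lambda>\<omega>. norm (X0 \<omega>)"] square_integrable by simp
  then show ?thesis
    by (simp add: integrable_norm_iff)
qed

lemma integrable_inner_square: "integrable M (\<lambda>\<omega>. (t \<bullet> X0 \<omega>)\<^sup>2)"
proof (rule Bochner_Integration.integrable_bound)
  show "integrable M (\<lambda>\<omega>. (norm t)\<^sup>2 * (norm (X0 \<omega>))\<^sup>2)"
    using square_integrable by simp
  show "AE \<omega> in M. norm ((t \<bullet> X0 \<omega>)\<^sup>2) \<le> norm ((norm t)\<^sup>2 * (norm (X0 \<omega>))\<^sup>2)"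
    using Cauchy_Schwarz_ineq2[of t]
    by (simp add: power_mult_distrib[symmetric] abs_le_square_iff[symmetric])
qed simp

text \<open>The locale admits any Euclidean value space, so that it covers the vectors themselves,
  centred indicators of sets and, here, the real projections to which the one-dimensional central
  limit theorem applies.\<close>

lemma inner_iid: "iid_centered M (\<lambda>i \<omega>. t \<bullet> X i \<omega>) (\<lambda>\<omega>. t \<bullet> X0 \<omega>)"
proof unfold_locales
  show "indep_vars (\<lambda>_. borel) (\<lambda>i \<omega>. t \<bullet> X i \<omega>) UNIV"
    using indep by (rule indep_vars_compose2) simp
  show "distr M borel (\<lambda>\<omega>. t \<bullet> X i \<omega>) = distr M borel (\<lambda>\<omega>. t \<bullet> X0 \<omega>)" for i
    using distr_distr[of "\<lambda>x. t \<bullet> x" borel borel "X i" M] distr_distr[of "\<lambda>x. t \<bullet> x" borel borel X0 M]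
      same_distr[of i] by (simp add: comp_def)
  show "(\<integral>\<omega>. t \<bullet> X0 \<omega> \<partial>M) = 0"
    using integrable_X0 by (simp add: mean_0)
qed (use integrable_inner_square in auto)

end

text \<open>The off-diagonal products have mean zero by independence and centring.\<close>

lemma (in prob_space) second_moment_sum_real:
  fixes X :: "nat \<Rightarrow> 'a \<Rightarrow> real"
  assumes "iid_centered M X X0"
  shows "integrable M (\<lambda>\<omega>. (\<Sum>i<n. X i \<omega>)\<^sup>2)"
    "(\<integral>\<omega>. (\<Sum>i<n. X i \<omega>)\<^sup>2 \<partial>M) = n * (\<integral>\<omega>. (X0 \<omega>)\<^sup>2 \<partial>M)"
proof -
  interpret iid_centered M X X0 by fact
  let ?V = "\<integral>\<omega>. (X0 \<omega>)\<^sup>2 \<partial>M"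
  have X: "integrable M (X i)" "(\<integral>\<omega>. X i \<omega> \<partial>M) = 0" for i
    using integrable_iff_X0[of "\<lambda>x. x" i] integral_eq_X0[of "\<lambda>x. x" i] integrable_X0 mean_0 by auto
  have prod: "integrable M (\<lambda>\<omega>. X i \<omega> * X j \<omega>) \<and>
      (\<integral>\<omega>. X i \<omega> * X j \<omega> \<partial>M) = (if i = j then ?V else 0)" for i j
  proof (cases "i = j")
    case True
    have "integrable M (\<lambda>\<omega>. (X i \<omega>)\<^sup>2)" "(\<integral>\<omega>. (X i \<omega>)\<^sup>2 \<partial>M) = ?V"
      using integrable_iff_X0[of "\<lambda>x. x\<^sup>2" i] integral_eq_X0[of "\<lambda>x. x\<^sup>2" i] square_integrable by auto
    with True show ?thesis by (simp add: power2_eq_square)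
  next
    case False
    have "indep_vars (\<lambda>_. borel) X {i, j}"
      by (rule indep_vars_subset[OF indep]) simp
    from indep_vars_lebesgue_integral[OF _ this] indep_vars_integrable[OF _ this] X False
    show ?thesis by simp
  qed
  have sq: "(\<Sum>i<n. X i \<omega>)\<^sup>2 = (\<Sum>i<n. \<Sum>j<n. X i \<omega> * X j \<omega>)" for \<omega>
    by (simp add: power2_eq_square sum_product)
  show "integrable M (\<lambda>\<omega>. (\<Sum>i<n. X i \<omega>)\<^sup>2)" "(\<integral>\<omega>. (\<Sum>i<n. X i \<omega>)\<^sup>2 \<partial>M) = n * ?V"
    using prod by (simp_all add: sq)
qed

context iid_centered
begin

text \<open>The squared norm is the sum of the squared coordinates, so the real case is added up
  over the basis.\<close>

lemma second_moment_sum: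
  shows "integrable M (\<lambda>\<omega>. (norm (\<Sum>i<n. X i \<omega>))\<^sup>2)"
    and "(\<integral>\<omega>. (norm (\<Sum>i<n. X i \<omega>))\<^sup>2 \<partial>M) = n * (\<integral>\<omega>. (norm (X0 \<omega>))\<^sup>2 \<partial>M)"
proof -
  have sq: "(norm x)\<^sup>2 = (\<Sum>b\<in>Basis. (b \<bullet> x)\<^sup>2)" for x :: 'v
    unfolding power2_norm_eq_inner by (subst euclidean_inner) (simp add: power2_eq_square inner_commute)
  note m = second_moment_sum_real[OF inner_iid, of _ n]
  show "integrable M (\<lambda>\<omega>. (norm (\<Sum>i<n. X i \<omega>))\<^sup>2)"
    using m(1) by (simp add: sq inner_sum_right)
  show "(\<integral>\<omega>. (norm (\<Sum>i<n. X i \<omega>))\<^sup>2 \<partial>M) = n * (\<integral>\<omega>. (norm (X0 \<omega>))\<^sup>2 \<partial>M)"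
    using m integrable_inner_square by (simp add: sq inner_sum_right sum_distrib_left)
qed

lemma prob_norm_sum_ge:
  assumes "a > 0"
  shows "\<P>(\<omega> in M. norm (\<Sum>i<n. X i \<omega>) \<ge> a) \<le> n * (\<integral>\<omega>. (norm (X0 \<omega>))\<^sup>2 \<partial>M) / a\<^sup>2"
proof -
  have "\<P>(\<omega> in M. (norm (\<Sum>i<n. X i \<omega>))\<^sup>2 \<ge> a\<^sup>2) \<le> (\<integral>\<omega>. (norm (\<Sum>i<n. X i \<omega>))\<^sup>2 \<partial>M) / a\<^sup>2"
    using second_moment_sum(1) assms by (intro integral_Markov_inequality_measure[of _ _ "space M"]) auto
  moreover have "(norm x)\<^sup>2 \<ge> a\<^sup>2 \<longleftrightarrow> norm x \<ge> a" for x :: 'v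
    using assms by (simp add: power2_le_iff_abs_le)
  ultimately show ?thesis
    by (simp add: second_moment_sum(2))
qed

lemma weak_law:
  fixes a :: real
  assumes "a > 0"
  shows "(\<lambda>n. \<P>(\<omega> in M. norm (\<Sum>i<n. X i \<omega>) \<ge> a * n)) \<longlonglongrightarrow> 0"
proof (rule Lim_null_comparison)
  let ?V = "\<integral>\<omega>. (norm (X0 \<omega>))\<^sup>2 \<partial>M"
  show "\<forall>\<^sub>F n in sequentially. norm \<P>(\<omega> in M. norm (\<Sum>i<n. X i \<omega>) \<ge> a * n) \<le> (?V / a\<^sup>2) / n"
    using eventually_gt_at_top[of 0]
  proof eventually_elim
    case (elim n)
    then show ?case
      using prob_norm_sum_ge[of "a * n" n] assms by (simp add: power2_eq_square field_simps)
  qed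
  show "(\<lambda>n. (?V / a\<^sup>2) / real n) \<longlonglongrightarrow> 0"
    by (rule lim_const_over_n)
qed

text \<open>For \<open>n > 0\<close> the second moment of the scaled sum does not depend on
  \<open>n\<close>, so the Chebyshev bound is uniform.\<close>

lemma scaled_sum_tight:
  assumes "e > 0"
  shows "\<exists>R. \<forall>n. \<P>(\<omega> in M. norm ((1 / sqrt n) *\<^sub>R (\<Sum>i<n. X i \<omega>)) > R) < e"
proof -
  let ?V = "\<integral>\<omega>. (norm (X0 \<omega>))\<^sup>2 \<partial>M"
  have "?V \<ge> 0" by simp
  \<comment> \<open>The summand 1 makes \<open>R\<^sup>2 > ?V / e\<close> strict and keeps
    \<open>R\<close> positive when \<open>?V = 0\<close>.\<close>
  define R where "R = sqrt (?V / e) + 1"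
  have "R > 0" "R\<^sup>2 > ?V / e"
  proof -
    show "R > 0"
      using assms by (simp add: R_def add_nonneg_pos)
    have "?V / e = (sqrt (?V / e))\<^sup>2"
      using assms by simp
    also have "\<dots> < R\<^sup>2"
      using assms by (intro power_strict_mono) (auto simp: R_def)
    finally show "R\<^sup>2 > ?V / e" .
  qed
  have "\<P>(\<omega> in M. norm ((1 / sqrt n) *\<^sub>R (\<Sum>i<n. X i \<omega>)) > R) < e" for n
  proof (cases "n = 0")
    case True
    with \<open>R > 0\<close> assms show ?thesis by simp
  next
    case False
    have "\<P>(\<omega> in M. norm ((1 / sqrt n) *\<^sub>R (\<Sum>i<n. X i \<omega>)) > R) \<le>
        \<P>(\<omega> in M. norm (\<Sum>i<n. X i \<omega>) \<ge> R * sqrt n)"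
      using False by (intro finite_measure_mono) (auto simp: field_simps)
    also have "\<dots> \<le> n * ?V / (R * sqrt n)\<^sup>2"
      using \<open>R > 0\<close> False by (intro prob_norm_sum_ge) simp
    also have "\<dots> = ?V / R\<^sup>2"
      using False by (simp add: power_mult_distrib)
    also have "\<dots> < e"
      using \<open>R\<^sup>2 > ?V / e\<close> assms \<open>R > 0\<close> by (simp add: field_simps)
    finally show ?thesis .
  qed
  then show ?thesis by blast
qed

text \<open>For positive variance the test function is rescaled to
  \<open>\<lambda>x. \<phi> (\<sigma> * x)\<close>, which matches the normalised limit law. For zero
  variance both projections vanish almost surely, and the sequence is constant.\<close>

lemma inner_central_limit:
  fixes \<phi> :: "real \<Rightarrow> real"
  defines "v \<equiv> \<lambda>t. \<integral>\<omega>. (t \<bullet> X0 \<omega>)\<^sup>2 \<partial>M"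
  assumes N: "prob_space N" "Y \<in> borel_measurable N"
    and normal: "v t > 0 \<Longrightarrow>
        distributed N lborel (\<lambda>\<omega>. t \<bullet> Y \<omega>) (\<lambda>x. ennreal (normal_density 0 (sqrt (v t)) x))"
      "v t = 0 \<Longrightarrow> AE \<omega> in N. t \<bullet> Y \<omega> = 0"
    and \<phi>: "\<And>x. isCont \<phi> x" "\<And>x. \<bar>\<phi> x\<bar> \<le> B"
  shows "(\<lambda>n. \<integral>\<omega>. \<phi> (t \<bullet> (1 / sqrt n) *\<^sub>R (\<Sum>i<n. X i \<omega>)) \<partial>M) \<longlonglongrightarrow> (\<integral>\<omega>. \<phi> (t \<bullet> Y \<omega>) \<partial>N)"
proof -
  interpret N: prob_space N by fact
  note [measurable] = N(2)
  interpret Z: iid_centered M "\<lambda>i \<omega>. t \<bullet> X i \<omega>" "\<lambda>\<omega>. t \<bullet> X0 \<omega>"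
    by (rule inner_iid)
  have [measurable]: "\<phi> \<in> borel_measurable borel"
    using \<phi>(1) by (intro borel_measurable_continuous_onI continuous_at_imp_continuous_on) auto
  have "v t \<ge> 0" by (simp add: v_def)
  then consider "v t > 0" | "v t = 0" by linarith
  then show ?thesis
  proof cases
    case 1
    define \<sigma> where "\<sigma> = sqrt (v t)"
    have \<sigma>: "\<sigma> > 0" "\<sigma>\<^sup>2 = v t"
      using 1 by (auto simp: \<sigma>_def)
    have mean: "expectation (\<lambda>\<omega>. t \<bullet> X i \<omega>) = 0" for i
      using Z.integral_eq_X0[of "\<lambda>x. x" i] Z.mean_0 by simp
    have sq: "integrable M (\<lambda>\<omega>. (t \<bullet> X i \<omega>)\<^sup>2)" "expectation (\<lambda>\<omega>. (t \<bullet> X i \<omega>)\<^sup>2) = \<sigma>\<^sup>2" for i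
      using Z.integrable_iff_X0[of "\<lambda>x. x\<^sup>2" i] Z.integral_eq_X0[of "\<lambda>x. x\<^sup>2" i] integrable_inner_square[of t]
      by (auto simp: \<sigma>(2) v_def)
    have "weak_conv_m (\<lambda>n. distr M borel (\<lambda>\<omega>. (\<Sum>i<n. t \<bullet> X i \<omega>) / sqrt (n * \<sigma>\<^sup>2))) std_normal_distribution"
      using mean sq \<sigma>(1) by (intro central_limit_theorem_zero_mean[OF Z.indep _ _ _ _ Z.same_distr]) auto
    then have "(\<lambda>n. \<integral>x. \<phi> (\<sigma> * x) \<partial>distr M borel (\<lambda>\<omega>. (\<Sum>i<n. t \<bullet> X i \<omega>) / sqrt (n * \<sigma>\<^sup>2)))
        \<longlonglongrightarrow> (\<integral>x. \<phi> (\<sigma> * x) \<partial>std_normal_distribution)"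
      using \<phi>(2)
      by (intro weak_conv_imp_integral_bdd_continuous_conv[where B=B] real_distribution_distr
          real_dist_normal_dist isCont_o2[OF _ \<phi>(1)]) auto
    moreover have "(\<integral>x. \<phi> (\<sigma> * x) \<partial>distr M borel (\<lambda>\<omega>. (\<Sum>i<n. t \<bullet> X i \<omega>) / sqrt (n * \<sigma>\<^sup>2))) =
        (\<integral>\<omega>. \<phi> (t \<bullet> (1 / sqrt n) *\<^sub>R (\<Sum>i<n. X i \<omega>)) \<partial>M)" for n
      using \<sigma>(1) by (simp add: integral_distr real_sqrt_mult inner_sum_right mult.commute)
    moreover have "(\<integral>x. \<phi> (\<sigma> * x) \<partial>std_normal_distribution) = (\<integral>\<omega>. \<phi> (t \<bullet> Y \<omega>) \<partial>N)"
    proof -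
      have "distributed N lborel (\<lambda>\<omega>. (t \<bullet> Y \<omega>) / \<sigma>) std_normal_density"
        using normal(1)[OF 1] N.normal_standard_normal_convert[OF \<sigma>(1), of "\<lambda>\<omega>. t \<bullet> Y \<omega>" 0]
        by (simp add: \<sigma>_def)
      from distributed_distr_eq_density[OF this]
      have "std_normal_distribution = distr N lborel (\<lambda>\<omega>. (t \<bullet> Y \<omega>) / \<sigma>)"
        by simp
      then show ?thesis
        using \<sigma>(1) by (simp add: integral_distr)
    qed
    ultimately show ?thesis by simp
  next
    case 2
    have "AE \<omega> in M. (t \<bullet> X0 \<omega>)\<^sup>2 = 0"
      using 2 integrable_inner_square[of t] integral_nonneg_eq_0_iff_AE[of M "\<lambda>\<omega>. (t \<bullet> X0 \<omega>)\<^sup>2"]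
      by (simp add: v_def)
    then have "AE x in distr M borel X0. t \<bullet> x = 0"
      by (subst AE_distr_iff) auto
    then have "AE \<omega> in M. t \<bullet> X i \<omega> = 0" for i
      unfolding same_distr[of i, symmetric] by (subst (asm) AE_distr_iff) auto
    then have "AE \<omega> in M. \<forall>i. t \<bullet> X i \<omega> = 0"
      by (simp add: AE_all_countable)
    then have "(\<integral>\<omega>. \<phi> (t \<bullet> (1 / sqrt n) *\<^sub>R (\<Sum>i<n. X i \<omega>)) \<partial>M) = (\<integral>\<omega>. \<phi> 0 \<partial>M)" for n
      by (intro integral_cong_AE) (auto simp: inner_sum_right)
    moreover have "(\<integral>\<omega>. \<phi> (t \<bullet> Y \<omega>) \<partial>N) = (\<integral>\<omega>. \<phi> 0 \<partial>N)"
      using normal(2)[OF 2] by (intro integral_cong_AE) auto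
    ultimately show ?thesis
      by (simp add: prob_space N.prob_space)
  qed
qed

theorem multivariate_central_limit:
  fixes f :: "'v \<Rightarrow> real"
  defines "v \<equiv> \<lambda>t. \<integral>\<omega>. (t \<bullet> X0 \<omega>)\<^sup>2 \<partial>M"
  assumes N: "prob_space N" "Y \<in> borel_measurable N"
    and normal: "\<And>t. v t > 0 \<Longrightarrow>
        distributed N lborel (\<lambda>\<omega>. t \<bullet> Y \<omega>) (\<lambda>x. ennreal (normal_density 0 (sqrt (v t)) x))"
      "\<And>t. v t = 0 \<Longrightarrow> AE \<omega> in N. t \<bullet> Y \<omega> = 0"
    and f: "continuous_on UNIV f" "bounded (range f)"
  shows "(\<lambda>n. \<integral>\<omega>. f ((1 / sqrt n) *\<^sub>R (\<Sum>i<n. X i \<omega>)) \<partial>M) \<longlonglongrightarrow> (\<integral>\<omega>. f (Y \<omega>) \<partial>N)"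
proof (rule integral_tendsto_of_trig[OF prob_space_axioms _ N _ _ scaled_sum_tight f])
  note lim = inner_central_limit[OF N normal[unfolded v_def], where B=1]
  show "(\<lambda>n. \<integral>\<omega>. cos (t \<bullet> (1 / sqrt n) *\<^sub>R (\<Sum>i<n. X i \<omega>)) \<partial>M) \<longlonglongrightarrow> (\<integral>\<omega>. cos (t \<bullet> Y \<omega>) \<partial>N)" for t
    by (rule lim) auto
  show "(\<lambda>n. \<integral>\<omega>. sin (t \<bullet> (1 / sqrt n) *\<^sub>R (\<Sum>i<n. X i \<omega>)) \<partial>M) \<longlonglongrightarrow> (\<integral>\<omega>. sin (t \<bullet> Y \<omega>) \<partial>N)" for t
    by (rule lim) auto
qed auto

end

section \<open>Convergence of the profile function\<close>

definition support_function :: "'r::euclidean_space set \<Rightarrow> 'r \<Rightarrow> real" where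
  "support_function K x = (SUP \<zeta>\<in>K. \<zeta> \<bullet> x)"

lemma support_function_attained:
  fixes K :: "'r::euclidean_space set"
  assumes "compact K" "K \<noteq> {}"
  obtains \<zeta> where "\<zeta> \<in> K" "support_function K x = \<zeta> \<bullet> x" "\<And>\<zeta>'. \<zeta>' \<in> K \<Longrightarrow> \<zeta>' \<bullet> x \<le> \<zeta> \<bullet> x"
proof -
  obtain \<zeta> where \<zeta>: "\<zeta> \<in> K" "\<forall>\<zeta>'\<in>K. \<zeta>' \<bullet> x \<le> \<zeta> \<bullet> x"
    using continuous_attains_sup[OF assms, of "\<lambda>\<zeta>. \<zeta> \<bullet> x"] continuous_on_inner[of K id "\<lambda>_. x"]
    by auto
  then have "support_function K x = \<zeta> \<bullet> x"
    unfolding support_function_def by (intro cSup_eq_maximum) auto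
  with \<zeta> that show thesis by blast
qed

text \<open>A maximiser at \<open>x\<close> is a competitor at \<open>y\<close>, so the function is
  Lipschitz with a norm bound of \<open>K\<close> as constant.\<close>

lemma continuous_on_support_function:
  fixes K :: "'r::euclidean_space set"
  assumes "compact K" "K \<noteq> {}"
  shows "continuous_on UNIV (support_function K)"
proof -
  let ?S = "support_function K"
  obtain B where B: "\<And>\<zeta>. \<zeta> \<in> K \<Longrightarrow> norm \<zeta> \<le> B"
    using compact_imp_bounded[OF assms(1)] by (auto simp: bounded_iff)
  have "B \<ge> 0"
    using assms(2) B norm_ge_zero order_trans by blast
  have le: "?S x \<le> ?S y + B * dist x y" for x y
  proof -
    obtain \<zeta> where \<zeta>: "\<zeta> \<in> K" "?S x = \<zeta> \<bullet> x"
      using support_function_attained[OF assms] by metis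
    obtain \<xi> where "?S y = \<xi> \<bullet> y" "\<And>\<zeta>'. \<zeta>' \<in> K \<Longrightarrow> \<zeta>' \<bullet> y \<le> \<xi> \<bullet> y"
      using support_function_attained[OF assms, of y] by metis
    then have "\<zeta> \<bullet> y \<le> ?S y"
      using \<zeta>(1) by simp
    moreover have "\<zeta> \<bullet> (x - y) \<le> B * dist x y"
      using norm_cauchy_schwarz[of \<zeta> "x - y"] mult_right_mono[OF B[OF \<zeta>(1)], of "norm (x - y)"]
      by (simp add: dist_norm)
    ultimately show ?thesis
      by (simp add: \<zeta>(2) inner_diff_right)
  qed
  have "dist (?S x) (?S y) \<le> B * dist x y" for x y
    using le[of x y] le[of y x] by (simp add: dist_real_def dist_commute)
  then have "B-lipschitz_on UNIV ?S"
    using \<open>B \<ge> 0\<close> by (intro lipschitz_onI) auto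
  then show ?thesis
    by (rule lipschitz_on_continuous_on)
qed

section \<open>Sample frequencies and the profile of a random sample\<close>

lemma (in prob_space) iid_centered_compose:
  fixes Ws :: "nat \<Rightarrow> 'a \<Rightarrow> 'w::topological_space" and \<phi> :: "'w \<Rightarrow> 'v::euclidean_space"
  assumes "indep_vars (\<lambda>_. borel) Ws UNIV" "\<And>i. distr M borel (Ws i) = distr M borel W"
    and [measurable]: "W \<in> borel_measurable M" "\<phi> \<in> borel_measurable borel"
    and "integrable M (\<lambda>\<omega>. (norm (\<phi> (W \<omega>)))\<^sup>2)" "(\<integral>\<omega>. \<phi> (W \<omega>) \<partial>M) = 0"
  shows "iid_centered M (\<lambda>i \<omega>. \<phi> (Ws i \<omega>)) (\<lambda>\<omega>. \<phi> (W \<omega>))"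
proof unfold_locales
  show "indep_vars (\<lambda>_. borel) (\<lambda>i \<omega>. \<phi> (Ws i \<omega>)) UNIV"
    using assms(1) by (rule indep_vars_compose2) simp
  have [measurable]: "Ws i \<in> borel_measurable M" for i
    using assms(1) by (auto simp: indep_vars_def)
  show "distr M borel (\<lambda>\<omega>. \<phi> (Ws i \<omega>)) = distr M borel (\<lambda>\<omega>. \<phi> (W \<omega>))" for i
    using distr_distr[of \<phi> borel borel "Ws i" M] distr_distr[of \<phi> borel borel W M] assms(2)[of i]
    by (simp add: comp_def)
qed (use assms in auto)

text \<open>Weak law for the centred indicator of \<open>A\<close>: fewer than half of the expected
  visits means a deviation of at least \<open>p / 2 * n\<close>.\<close>

lemma (in prob_space) prob_few_visits_tendsto_0:
  fixes Ws :: "nat \<Rightarrow> 'a \<Rightarrow> 'w::topological_space"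
  assumes Ws: "indep_vars (\<lambda>_. borel) Ws UNIV" "\<And>i. distr M borel (Ws i) = distr M borel W"
    and W [measurable]: "W \<in> borel_measurable M" and A [measurable]: "A \<in> sets borel"
    and p: "p = \<P>(\<omega> in M. W \<omega> \<in> A)" "p > 0"
  shows "(\<lambda>n. \<P>(\<omega> in M. real (card {i. i < n \<and> Ws i \<omega> \<in> A}) < p / 2 * n)) \<longlonglongrightarrow> 0"
proof -
  have [measurable]: "Ws i \<in> borel_measurable M" for i
    using Ws(1) by (auto simp: indep_vars_def)
  let ?\<phi> = "\<lambda>w. indicator A w - p :: real"
  have bound: "\<bar>?\<phi> w\<bar> \<le> 1" for w
    using p prob_le_1 by (auto simp: indicator_def)
  interpret I: iid_centered M "\<lambda>i \<omega>. ?\<phi> (Ws i \<omega>)" "\<lambda>\<omega>. ?\<phi> (W \<omega>)"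
  proof (rule iid_centered_compose[OF Ws W])
    show "integrable M (\<lambda>\<omega>. (norm (?\<phi> (W \<omega>)))\<^sup>2)"
      using bound by (intro integrable_const_bound[where B=1]) (auto simp: abs_square_le_1)
    have "integrable M (\<lambda>\<omega>. indicator A (W \<omega>) :: real)"
      by (intro integrable_const_bound[where B=1]) auto
    moreover have "(\<integral>\<omega>. indicator A (W \<omega>) \<partial>M) = p"
    proof -
      have "(\<integral>\<omega>. indicator A (W \<omega>) \<partial>M) = (\<integral>\<omega>. indicator {\<omega>\<in>space M. W \<omega> \<in> A} \<omega> \<partial>M :: real)"
        by (intro Bochner_Integration.integral_cong) (auto simp: indicator_def)
      then show ?thesis
        by (simp add: p(1))
    qed
    ultimately show "(\<integral>\<omega>. ?\<phi> (W \<omega>) \<partial>M) = 0"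
      by (simp add: prob_space)
  qed simp
  have "p / 2 > 0"
    using p(2) by simp
  show ?thesis
  proof (rule Lim_null_comparison[OF _ I.weak_law[OF \<open>p / 2 > 0\<close>]])
    show "\<forall>\<^sub>F n in sequentially. norm \<P>(\<omega> in M. real (card {i. i < n \<and> Ws i \<omega> \<in> A}) < p / 2 * n) \<le>
        \<P>(\<omega> in M. norm (\<Sum>i<n. ?\<phi> (Ws i \<omega>)) \<ge> p / 2 * n)"
    proof (rule always_eventually, rule allI)
      fix n
      have "(\<Sum>i<n. ?\<phi> (Ws i \<omega>)) = real (card {i. i < n \<and> Ws i \<omega> \<in> A}) - p * n" for \<omega>
      proof -
        have "(\<Sum>i<n. indicator A (Ws i \<omega>)) = (\<Sum>i\<in>{i. i < n \<and> Ws i \<omega> \<in> A}. 1 :: real)"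
          by (intro sum.mono_neutral_cong_right) (auto simp: indicator_def)
        then show ?thesis
          by (simp add: sum_subtractf mult.commute)
      qed
      then show "norm \<P>(\<omega> in M. real (card {i. i < n \<and> Ws i \<omega> \<in> A}) < p / 2 * n) \<le>
          \<P>(\<omega> in M. norm (\<Sum>i<n. ?\<phi> (Ws i \<omega>)) \<ge> p / 2 * n)"
        by (auto intro!: finite_measure_mono simp del: of_nat_less_iff)
    qed
  qed
qed

text \<open>Collects what the limit argument takes from the theorem: full support in place of the
  density, continuity in place of the derivative, and compactness of the dual set in place of
  A4.\<close>

locale profile_sample = continuous_metric c + prob_space M
  for c :: "'w::euclidean_space \<Rightarrow> 'w \<Rightarrow> real" and M :: "'a measure" +
  fixes W :: "'a \<Rightarrow> 'w" and Ws :: "nat \<Rightarrow> 'a \<Rightarrow> 'w"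
    and h :: "'w \<Rightarrow> 'l \<Rightarrow> 'r::euclidean_space" and \<theta> :: 'l
  assumes W [measurable]: "W \<in> borel_measurable M"
    and indep: "indep_vars (\<lambda>_. borel) Ws UNIV"
    and same_distr: "\<And>i. distr M borel (Ws i) = distr M borel W"
    and full_support: "\<And>A. open A \<Longrightarrow> A \<noteq> {} \<Longrightarrow> \<P>(\<omega> in M. W \<omega> \<in> A) > 0"
    and continuous_h: "continuous_on UNIV (\<lambda>u. h u \<theta>)"
    and square_integrable_h: "integrable M (\<lambda>\<omega>. (norm (h (W \<omega>) \<theta>))\<^sup>2)"
    and mean_h: "(\<integral>\<omega>. h (W \<omega>) \<theta> \<partial>M) = 0"
    and compact_dual: "compact (lipschitz_dual c (\<lambda>u. h u \<theta>))"
begin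

abbreviation "K \<equiv> lipschitz_dual c (\<lambda>u. h u \<theta>)"
abbreviation "S \<equiv> support_function K"
abbreviation "Hn n \<omega> \<equiv> (1 / sqrt (real n)) *\<^sub>R (\<Sum>i<n. h (Ws i \<omega>) \<theta>)"
abbreviation "R n \<omega> \<equiv> ennreal (sqrt (real n)) * profile_function c h n (\<lambda>i. Ws i \<omega>) \<theta>"

lemma Ws [measurable]: "Ws i \<in> borel_measurable M"
  using indep by (auto simp: indep_vars_def)

lemma h_measurable [measurable]: "(\<lambda>u. h u \<theta>) \<in> borel_measurable borel"
  using continuous_h by (rule borel_measurable_continuous_onI)

sublocale H: iid_centered M "\<lambda>i \<omega>. h (Ws i \<omega>) \<theta>" "\<lambda>\<omega>. h (W \<omega>) \<theta>"
  by (rule iid_centered_compose[OF indep same_distr W h_measurable square_integrable_h mean_h])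

lemma dual_nonempty: "K \<noteq> {}"
  using zero_in_lipschitz_dual by blast

lemma support_upper: "\<zeta> \<in> K \<Longrightarrow> \<zeta> \<bullet> x \<le> S x"
  using support_function_attained[OF compact_dual dual_nonempty, of x] by metis

lemma support_nonneg: "0 \<le> S x"
  using support_upper[OF zero_in_lipschitz_dual] by simp

lemma support_measurable [measurable]: "S \<in> borel_measurable borel"
  by (intro borel_measurable_continuous_onI continuous_on_support_function compact_dual dual_nonempty)

lemma support_scale:
  assumes "a \<ge> 0"
  shows "S (a *\<^sub>R x) = a * S x"
proof -
  obtain \<zeta> where \<zeta>: "\<zeta> \<in> K" "S x = \<zeta> \<bullet> x" "\<And>\<zeta>'. \<zeta>' \<in> K \<Longrightarrow> \<zeta>' \<bullet> x \<le> \<zeta> \<bullet> x"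
    by (rule support_function_attained[OF compact_dual dual_nonempty, of x]) blast
  have "S (a *\<^sub>R x) = \<zeta> \<bullet> (a *\<^sub>R x)"
    unfolding support_function_def using \<zeta> assms by (intro cSup_eq_maximum) (auto intro: mult_left_mono)
  with \<zeta>(2) show ?thesis by simp
qed

lemma profile_measurable: "R n \<in> borel_measurable M"
proof -
  have "(\<lambda>\<omega> i. Ws i \<omega>) \<in> borel_measurable M"
    by (rule measurable_coordinatewise_then_product) simp
  then show ?thesis
    using measurable_compose[OF _ borel_measurable_profile_function[of h n \<theta>]]
    by (intro borel_measurable_times_ennreal borel_measurable_const)
qed

lemma Hn_eq_mean:
  assumes "n > 0"
  shows "Hn n \<omega> = sqrt n *\<^sub>R ((1 / real n) *\<^sub>R (\<Sum>i<n. h (Ws i \<omega>) \<theta>))"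
proof -
  have "sqrt n * (1 / real n) = 1 / sqrt n"
    using assms by (simp add: divide_simps)
  then show ?thesis by simp
qed

text \<open>The maximiser at the sample mean is itself a member of \<open>K\<close>, so weak duality
  applies to it; no exceptional event arises.\<close>

lemma support_le_profile:
  assumes "n > 0"
  shows "ennreal (S (Hn n \<omega>)) \<le> R n \<omega>"
proof -
  define x where "x = (1 / real n) *\<^sub>R (\<Sum>i<n. h (Ws i \<omega>) \<theta>)"
  obtain \<zeta> where \<zeta>: "\<zeta> \<in> K" "S x = \<zeta> \<bullet> x"
    by (rule support_function_attained[OF compact_dual dual_nonempty, of x]) blast
  have "S (Hn n \<omega>) = sqrt n * (\<zeta> \<bullet> x)"
    unfolding Hn_eq_mean[OF assms] by (simp add: support_scale \<zeta>(2) flip: x_def)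
  then have "ennreal (S (Hn n \<omega>)) = ennreal (sqrt n) * ennreal (\<zeta> \<bullet> x)"
    by (simp only: ennreal_mult' real_sqrt_ge_zero of_nat_0_le_iff)
  also have "\<dots> \<le> R n \<omega>"
    unfolding x_def
    by (intro mult_left_mono lipschitz_dual_le_profile_function[where h=h and \<theta>=\<theta>, OF \<zeta>(1) continuous_h]) simp
  finally show ?thesis .
qed

text \<open>The upper bound can fail only if the mean is not small or one of the finitely many sets
  \<open>A\<close> receives too few sample points; these events have vanishing probability.\<close>

lemma prob_profile_gt_tendsto_0:
  assumes "\<epsilon> > 0"
  shows "(\<lambda>n. \<P>(\<omega> in M. R n \<omega> > ennreal (S (Hn n \<omega>) + \<epsilon> * norm (Hn n \<omega>)))) \<longlonglongrightarrow> 0"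
proof -
  obtain J \<kappa> where J: "finite J" "\<kappa> > 0" "\<And>A b. (A, b) \<in> J \<Longrightarrow> open A \<and> A \<noteq> {}"
    "\<And>A b a. (A, b) \<in> J \<Longrightarrow> a \<in> A \<Longrightarrow> \<kappa> \<le> c a b"
    "\<And>\<zeta>. infdist \<zeta> K \<ge> \<epsilon> \<Longrightarrow> \<exists>(A, b)\<in>J. \<forall>a\<in>A. c a b < \<zeta> \<bullet> (h b \<theta> - h a \<theta>)"
    using finite_strict_cover[OF compact_dual continuous_h assms] by blast
  define p where "p A = \<P>(\<omega> in M. W \<omega> \<in> A)" for A
  have p: "p A > 0" if "(A, b) \<in> J" for A b
    using full_support J(3)[OF that] by (simp add: p_def)
  \<comment> \<open>Half the least probability of a set \<open>A\<close>, a common lower bound for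
    the fractions of visits; the inserted 1 covers an empty \<open>J\<close>.\<close>
  define \<beta> where "\<beta> = Min (insert 1 ((\<lambda>j. p (fst j) / 2) ` J))"
  have "\<beta> > 0"
    using J(1) p by (auto simp: \<beta>_def)
  have \<beta>: "\<beta> \<le> p A / 2" if "(A, b) \<in> J" for A b
  proof -
    have "p A / 2 \<in> insert 1 ((\<lambda>j. p (fst j) / 2) ` J)"
      using that by force
    then show ?thesis
      unfolding \<beta>_def using J(1) by (intro Min_le) auto
  qed
  obtain B where B: "\<And>\<zeta>. \<zeta> \<in> K \<Longrightarrow> norm \<zeta> \<le> B"
    using compact_imp_bounded[OF compact_dual] by (auto simp: bounded_iff)
  have "B \<ge> 0"
    using B[OF zero_in_lipschitz_dual] by simp
  \<comment> \<open>Since \<open>S x \<le> B * norm x\<close>, a mean of norm at most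
    \<open>\<eta>\<close> has \<open>S x + \<epsilon> * norm x \<le> \<kappa> * \<beta>\<close>, the
    smallness required by \<open>profile_function_le\<close>.\<close>
  define \<eta> where "\<eta> = \<kappa> * \<beta> / (B + \<epsilon>)"
  have "\<eta> > 0"
    using \<open>\<kappa> > 0\<close> \<open>\<beta> > 0\<close> \<open>B \<ge> 0\<close> assms by (simp add: \<eta>_def add_nonneg_pos)
  let ?bad = "\<lambda>n. {\<omega>\<in>space M. R n \<omega> > ennreal (S (Hn n \<omega>) + \<epsilon> * norm (Hn n \<omega>))}"
  let ?far = "\<lambda>n. {\<omega>\<in>space M. norm (\<Sum>i<n. h (Ws i \<omega>) \<theta>) \<ge> \<eta> * n}"
  let ?few = "\<lambda>n j. {\<omega>\<in>space M. real (card {i. i < n \<and> Ws i \<omega> \<in> fst j}) < p (fst j) / 2 * n}"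
  have few_sets: "?few n j \<in> events" if "j \<in> J" for n j
  proof -
    have [measurable]: "fst j \<in> sets borel"
      using J(3)[of "fst j" "snd j"] that by simp
    have "card {i. i < n \<and> Ws i \<omega> \<in> fst j} = (\<Sum>i<n. indicator (fst j) (Ws i \<omega>))" for \<omega>
    proof -
      have "(\<Sum>i<n. indicator (fst j) (Ws i \<omega>)) = (\<Sum>i\<in>{i. i < n \<and> Ws i \<omega> \<in> fst j}. 1 :: nat)"
        by (intro sum.mono_neutral_cong_right) (auto simp: indicator_def)
      then show ?thesis by simp
    qed
    then have "real (card {i. i < n \<and> Ws i \<omega> \<in> fst j}) = (\<Sum>i<n. indicator (fst j) (Ws i \<omega>))" for \<omega>
      by (simp add: indicator_def of_bool_def if_distrib cong: if_cong)
    then show ?thesis by simp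
  qed
  have sub: "?bad n \<subseteq> ?far n \<union> (\<Union>j\<in>J. ?few n j)" if "n > 0" for n
  proof (rule subsetI, rule ccontr)
    fix \<omega> assume bad: "\<omega> \<in> ?bad n" and "\<omega> \<notin> ?far n \<union> (\<Union>j\<in>J. ?few n j)"
    then have far: "norm (\<Sum>i<n. h (Ws i \<omega>) \<theta>) < \<eta> * n"
      and few: "\<And>A b. (A, b) \<in> J \<Longrightarrow> p A / 2 * n \<le> card {i. i < n \<and> Ws i \<omega> \<in> A}"
      by force+
    define x where "x = (1 / real n) *\<^sub>R (\<Sum>i<n. h (Ws i \<omega>) \<theta>)"
    have x: "Hn n \<omega> = sqrt n *\<^sub>R x"
      unfolding x_def by (rule Hn_eq_mean[OF that])
    have "norm x \<le> \<eta>"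
      using far that by (simp add: x_def divide_simps mult.commute)
    have "S x \<le> B * norm x"
    proof -
      obtain \<zeta> where \<zeta>: "\<zeta> \<in> K" "S x = \<zeta> \<bullet> x"
        by (rule support_function_attained[OF compact_dual dual_nonempty, of x]) blast
      then show ?thesis
        using norm_cauchy_schwarz[of \<zeta> x] mult_right_mono[OF B[OF \<zeta>(1)], of "norm x"] by simp
    qed
    then have "S x + \<epsilon> * norm x \<le> (B + \<epsilon>) * norm x"
      by (simp add: distrib_right)
    also have "\<dots> \<le> (B + \<epsilon>) * \<eta>"
      using \<open>norm x \<le> \<eta>\<close> \<open>B \<ge> 0\<close> assms by (intro mult_left_mono) auto
    also have "\<dots> = \<kappa> * \<beta>"
      using \<open>B \<ge> 0\<close> assms by (simp add: \<eta>_def)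
    finally have small: "S x + \<epsilon> * norm x \<le> \<kappa> * \<beta>" .
    have "profile_function c h n (\<lambda>i. Ws i \<omega>) \<theta> \<le> ennreal (S x + \<epsilon> * norm x)"
    proof (rule profile_function_le[where h=h and \<theta>=\<theta> and w="\<lambda>i. Ws i \<omega>" and x=x and s="S x" and J=J, OF that J(1) assms \<open>\<kappa> > 0\<close> \<open>\<beta> > 0\<close> compact_dual continuous_h
          J(4,5) _ x_def support_upper small])
      fix A b assume "(A, b) \<in> J"
      then show "\<beta> * n \<le> card {i. i < n \<and> Ws i \<omega> \<in> A}"
        using mult_right_mono[OF \<beta>, of A b "real n"] few[of A b] by simp
    qed
    then have "R n \<omega> \<le> ennreal (sqrt n) * ennreal (S x + \<epsilon> * norm x)"
      by (rule mult_left_mono) simp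
    also have "\<dots> = ennreal (S (Hn n \<omega>) + \<epsilon> * norm (Hn n \<omega>))"
      unfolding x by (simp add: support_scale distrib_left mult_ac flip: ennreal_mult')
    finally have "\<not> R n \<omega> > ennreal (S (Hn n \<omega>) + \<epsilon> * norm (Hn n \<omega>))"
      by (simp only: not_less)
    moreover have "R n \<omega> > ennreal (S (Hn n \<omega>) + \<epsilon> * norm (Hn n \<omega>))"
      using bad unfolding mem_Collect_eq by (rule conjunct2)
    ultimately show False by contradiction
  qed
  show ?thesis
  proof (rule Lim_null_comparison)
    show "\<forall>\<^sub>F n in sequentially. norm (prob (?bad n)) \<le> prob (?far n) + (\<Sum>j\<in>J. prob (?few n j))"
      using eventually_gt_at_top[of 0]
    proof eventually_elim
      case (elim n)
      have few: "(\<Union>j\<in>J. ?few n j) \<in> events"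
        by (rule sets.finite_UN[OF J(1) few_sets])
      have far: "?far n \<in> events"
        by measurable
      have "prob (?bad n) \<le> prob (?far n \<union> (\<Union>j\<in>J. ?few n j))"
        by (rule finite_measure_mono[OF sub[OF elim] sets.Un[OF far few]])
      also have "\<dots> \<le> prob (?far n) + prob (\<Union>j\<in>J. ?few n j)"
        by (rule measure_Un_le[OF far few])
      also have "prob (\<Union>j\<in>J. ?few n j) \<le> (\<Sum>j\<in>J. prob (?few n j))"
        by (rule finite_measure_subadditive_finite[OF J(1)]) (use few_sets in blast)
      finally show ?case by simp
    qed
    have "(\<lambda>n. \<Sum>j\<in>J. prob (?few n j)) \<longlonglongrightarrow> 0"
    proof (rule tendsto_null_sum)
      fix j assume "j \<in> J"
      then have j: "(fst j, snd j) \<in> J" by simp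
      then show "(\<lambda>n. prob (?few n j)) \<longlonglongrightarrow> 0"
        using J(3)[OF j] p[OF j]
        by (intro prob_few_visits_tendsto_0[OF indep same_distr W]) (auto simp: p_def)
    qed
    from tendsto_add[OF H.weak_law[OF \<open>\<eta> > 0\<close>] this]
    show "(\<lambda>n. prob (?far n) + (\<Sum>j\<in>J. prob (?few n j))) \<longlonglongrightarrow> 0" by simp
  qed
qed

text \<open>Off an event of small probability both arguments of \<open>f\<close> are finite, lie in
  one bounded interval and differ by at most \<open>\<epsilon> * norm (Hn n \<omega>)\<close>.
  Uniform continuity on that interval then controls the difference.\<close>

lemma integral_profile_diff_tendsto_0:
  fixes f :: "ennreal \<Rightarrow> real"
  assumes f: "continuous_on UNIV f" "bounded (range f)"
  shows "(\<lambda>n. (\<integral>\<omega>. f (R n \<omega>) \<partial>M) - (\<integral>\<omega>. f (ennreal (S (Hn n \<omega>))) \<partial>M)) \<longlonglongrightarrow> 0"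
proof (rule LIMSEQ_I)
  fix r :: real assume "r > 0"
  note [measurable] = profile_measurable borel_measurable_continuous_onI[OF f(1)]
  obtain C where C: "\<And>y. \<bar>f y\<bar> \<le> C"
    using f(2) by (auto simp: bounded_iff)
  have "C \<ge> 0"
    using C[of 0] by linarith
  \<comment> \<open>The factor 8 makes the exceptional event contribute at most
    \<open>r / 2\<close>, beside \<open>r / 4\<close> from uniform continuity; \<open>C + 1\<close>
    avoids a zero denominator.\<close>
  define e where "e = r / (8 * (C + 1))"
  have e: "e > 0" "2 * C * (2 * e) \<le> r / 2"
    using \<open>r > 0\<close> \<open>C \<ge> 0\<close> by (auto simp: e_def field_simps)
  obtain T where T: "\<And>n. \<P>(\<omega> in M. norm (Hn n \<omega>) > T) < e"
    using H.scaled_sum_tight[OF e(1)] by blast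
  obtain B where B: "\<And>\<zeta>. \<zeta> \<in> K \<Longrightarrow> norm \<zeta> \<le> B"
    using compact_imp_bounded[OF compact_dual] by (auto simp: bounded_iff)
  have "B \<ge> 0"
    using B[OF zero_in_lipschitz_dual] by simp
  have S_le: "S x \<le> B * norm x" for x
  proof -
    obtain \<zeta> where \<zeta>: "\<zeta> \<in> K" "S x = \<zeta> \<bullet> x"
      by (rule support_function_attained[OF compact_dual dual_nonempty, of x]) blast
    then show ?thesis
      using norm_cauchy_schwarz[of \<zeta> x] mult_right_mono[OF B[OF \<zeta>(1)], of "norm x"] by simp
  qed
  have "uniformly_continuous_on {0..B * \<bar>T\<bar> + 1} (\<lambda>x. f (ennreal x))"
    by (intro compact_uniformly_continuous continuous_on_compose2[OF f(1)] continuous_on_ennreal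
        continuous_intros) auto
  then obtain d where d: "d > 0"
    "\<And>x y. x \<in> {0..B * \<bar>T\<bar> + 1} \<Longrightarrow> y \<in> {0..B * \<bar>T\<bar> + 1} \<Longrightarrow> dist x y < d \<Longrightarrow>
      dist (f (ennreal x)) (f (ennreal y)) < r / 4"
    unfolding uniformly_continuous_on_def using \<open>r > 0\<close> by (metis zero_less_divide_iff zero_less_numeral)
  \<comment> \<open>For norms up to \<open>\<bar>T\<bar>\<close> the slack must stay below the
    modulus \<open>d\<close> and within the extra unit length of the interval.\<close>
  define \<epsilon> where "\<epsilon> = min 1 (d / 2) / (\<bar>T\<bar> + 1)"
  have "\<epsilon> > 0"
    using d(1) by (simp add: \<epsilon>_def)
  have \<epsilon>: "\<epsilon> * t < d" "\<epsilon> * t \<le> 1" if "0 \<le> t" "t \<le> \<bar>T\<bar>" for t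
  proof -
    have "\<epsilon> * t \<le> \<epsilon> * (\<bar>T\<bar> + 1)"
      using that \<open>\<epsilon> > 0\<close> by (intro mult_left_mono) auto
    also have "\<dots> = min 1 (d / 2)"
      by (simp add: \<epsilon>_def)
    finally show "\<epsilon> * t < d" "\<epsilon> * t \<le> 1"
      using d(1) by auto
  qed
  let ?bad = "\<lambda>n. {\<omega>\<in>space M. R n \<omega> > ennreal (S (Hn n \<omega>) + \<epsilon> * norm (Hn n \<omega>))}"
  let ?big = "\<lambda>n. {\<omega>\<in>space M. norm (Hn n \<omega>) > T}"
  have [measurable]: "?bad n \<in> events" "?big n \<in> events" for n
    by measurable
  have "\<forall>\<^sub>F n in sequentially. prob (?bad n) < e"
    using prob_profile_gt_tendsto_0[OF \<open>\<epsilon> > 0\<close>] e(1) by (rule order_tendstoD)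
  moreover have "\<forall>\<^sub>F n in sequentially. n > (0::nat)"
    by (rule eventually_gt_at_top)
  ultimately have "\<forall>\<^sub>F n in sequentially.
      norm ((\<integral>\<omega>. f (R n \<omega>) \<partial>M) - (\<integral>\<omega>. f (ennreal (S (Hn n \<omega>))) \<partial>M) - 0) < r"
  proof eventually_elim
    case (elim n)
    have "\<bar>(\<integral>\<omega>. f (R n \<omega>) \<partial>M) - (\<integral>\<omega>. f (ennreal (S (Hn n \<omega>))) \<partial>M)\<bar> \<le> r / 4 + 2 * C * (2 * e)"
    proof (rule abs_integral_diff_le[where G="?bad n \<union> ?big n"])
      show "integrable M (\<lambda>\<omega>. f (R n \<omega>))" "integrable M (\<lambda>\<omega>. f (ennreal (S (Hn n \<omega>))))"
        using C by (auto intro!: integrable_const_bound[where B=C])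
      show "?bad n \<union> ?big n \<in> events"
        by measurable
      have "prob (?bad n \<union> ?big n) \<le> prob (?bad n) + prob (?big n)"
        by (intro measure_Un_le) measurable
      then show "prob (?bad n \<union> ?big n) \<le> 2 * e"
        using elim(1) T[of n] by simp
      show "\<bar>f (R n \<omega>) - f (ennreal (S (Hn n \<omega>)))\<bar> \<le> 2 * C" for \<omega>
        using C[of "R n \<omega>"] C[of "ennreal (S (Hn n \<omega>))"] by linarith
      fix \<omega> assume "\<omega> \<in> space M" "\<omega> \<notin> ?bad n \<union> ?big n"
      then have up: "R n \<omega> \<le> ennreal (S (Hn n \<omega>) + \<epsilon> * norm (Hn n \<omega>))" and "norm (Hn n \<omega>) \<le> T"
        by (auto simp: not_less)
      then have t: "norm (Hn n \<omega>) \<le> \<bar>T\<bar>" by linarith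
      \<comment> \<open>The upper bound is finite, so the profile is the image of a real
        number.\<close>
      obtain z where z: "z \<ge> 0" "R n \<omega> = ennreal z"
        using up by (metis ennreal_cases ennreal_less_top not_less top.extremum_uniqueI top.not_eq_extremum)
      have "S (Hn n \<omega>) \<le> z"
        using support_le_profile[OF elim(2), of \<omega>] z by (simp add: ennreal_le_iff)
      moreover have "z \<le> S (Hn n \<omega>) + \<epsilon> * norm (Hn n \<omega>)"
        using up \<open>\<epsilon> > 0\<close> support_nonneg[of "Hn n \<omega>"] unfolding z(2)
        by (subst (asm) ennreal_le_iff) auto
      moreover have "S (Hn n \<omega>) \<le> B * \<bar>T\<bar>"
        using S_le[of "Hn n \<omega>"] mult_left_mono[OF t \<open>B \<ge> 0\<close>] by linarith
      ultimately have "dist (f (ennreal z)) (f (ennreal (S (Hn n \<omega>)))) < r / 4"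
        using \<epsilon>[OF norm_ge_zero t] z(1) support_nonneg[of "Hn n \<omega>"]
        by (intro d(2)) (auto simp: dist_real_def)
      then show "\<bar>f (R n \<omega>) - f (ennreal (S (Hn n \<omega>)))\<bar> \<le> r / 4"
        by (simp add: z(2) dist_real_def)
    qed (use \<open>r > 0\<close> in simp)
    then show ?case
      using e(2) \<open>r > 0\<close> by simp
  qed
  then show "\<exists>n0. \<forall>n\<ge>n0. norm ((\<integral>\<omega>. f (R n \<omega>) \<partial>M) - (\<integral>\<omega>. f (ennreal (S (Hn n \<omega>))) \<partial>M) - 0) < r"
    by (simp add: eventually_sequentially)
qed

theorem profile_function_converges_in_distribution:
  assumes N: "prob_space N" "Y \<in> borel_measurable N"
    and normal:
      "\<And>t. (\<integral>\<omega>. (t \<bullet> h (W \<omega>) \<theta>)\<^sup>2 \<partial>M) > 0 \<Longrightarrow> distributed N lborel (\<lambda>\<omega>. t \<bullet> Y \<omega>)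
        (\<lambda>x. ennreal (normal_density 0 (sqrt (\<integral>\<omega>. (t \<bullet> h (W \<omega>) \<theta>)\<^sup>2 \<partial>M)) x))"
      "\<And>t. (\<integral>\<omega>. (t \<bullet> h (W \<omega>) \<theta>)\<^sup>2 \<partial>M) = 0 \<Longrightarrow> AE \<omega> in N. t \<bullet> Y \<omega> = 0"
  shows "converges_in_distribution M R N (\<lambda>\<omega>. ennreal (S (Y \<omega>)))"
  unfolding converges_in_distribution_def
proof (intro conjI allI impI)
  show "R n \<in> borel_measurable M" for n
    by (rule profile_measurable)
  show "(\<lambda>\<omega>. ennreal (S (Y \<omega>))) \<in> borel_measurable N"
    using N(2) by simp
  fix f :: "ennreal \<Rightarrow> real" assume f: "continuous_on UNIV f" "bounded (range f)"
  have "(\<lambda>n. \<integral>\<omega>. f (ennreal (S (Hn n \<omega>))) \<partial>M) \<longlonglongrightarrow> (\<integral>\<omega>. f (ennreal (S (Y \<omega>))) \<partial>N)"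
  proof (rule H.multivariate_central_limit[OF N normal])
    show "continuous_on UNIV (\<lambda>x. f (ennreal (S x)))"
      by (intro continuous_on_compose2[OF f(1)] continuous_on_ennreal
          continuous_on_support_function compact_dual dual_nonempty) auto
    show "bounded (range (\<lambda>x. f (ennreal (S x))))"
      using f(2) by (rule bounded_subset) auto
  qed
  from tendsto_add[OF integral_profile_diff_tendsto_0[OF f] this]
  show "(\<lambda>n. \<integral>\<omega>. f (R n \<omega>) \<partial>M) \<longlonglongrightarrow> (\<integral>\<omega>. f (ennreal (S (Y \<omega>))) \<partial>N)" by simp
qed

end

section \<open>Specialisation to the norm cost\<close>

lemma continuous_metric_lp_norm:
  assumes "1 / p + 1 / q = 1"
  shows "continuous_metric (\<lambda>u w :: real^'m. lp_norm q (u - w))"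
proof
  have q: "q \<ge> 1"
    using assms conjugate_exponent_ge_1[of q p] by (simp add: add.commute)
  fix x y z :: "real^'m"
  show "lp_norm q (x - x) = 0" by simp
  show "0 < lp_norm q (x - y)" if "x \<noteq> y"
    using that lp_norm_nonneg[of q "x - y"] lp_norm_eq_0_iff[OF q, of "x - y"] by simp
  show "lp_norm q (x - y) = lp_norm q (y - x)"
    using lp_norm_minus[of q "x - y"] by simp
  show "lp_norm q (x - z) \<le> lp_norm q (x - y) + lp_norm q (y - z)"
    using lp_norm_triangle[OF assms, of "x - y" "y - z"] by simp
  show "continuous_on UNIV (\<lambda>z::(real^'m) \<times> (real^'m). lp_norm q (fst z - snd z))"
    by (intro continuous_on_compose2[OF continuous_on_lp_norm[OF q]] continuous_intros) auto
qed

text \<open>Expanding the square identifies the quadratic form in \<open>multivariate_normal\<close>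
  with the second moment of a projection; the entries are integrable because the squared norm
  dominates them.\<close>

lemma inner_covariance_eq:
  fixes X :: "'a \<Rightarrow> real^'r"
  assumes [measurable]: "X \<in> borel_measurable M" and sq: "integrable M (\<lambda>\<omega>. (norm (X \<omega>))\<^sup>2)"
  shows "t \<bullet> ((\<chi> i j. \<integral>\<omega>. X \<omega> $ i * X \<omega> $ j \<partial>M) *v t) = (\<integral>\<omega>. (t \<bullet> X \<omega>)\<^sup>2 \<partial>M)"
proof -
  have [measurable]: "(\<lambda>x::real^'r. x $ i) \<in> borel_measurable borel" for i
    by (intro borel_measurable_continuous_onI continuous_intros)
  have int: "integrable M (\<lambda>\<omega>. X \<omega> $ i * X \<omega> $ j)" for i j
  proof (rule Bochner_Integration.integrable_bound[OF sq])
    have "\<bar>X \<omega> $ i\<bar> * \<bar>X \<omega> $ j\<bar> \<le> norm (X \<omega>) * norm (X \<omega>)" for \<omega>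
      by (intro mult_mono component_le_norm_cart) auto
    then show "AE \<omega> in M. norm (X \<omega> $ i * X \<omega> $ j) \<le> norm ((norm (X \<omega>))\<^sup>2)"
      by (simp add: abs_mult power2_eq_square)
  qed measurable
  have "(t \<bullet> X \<omega>)\<^sup>2 = (\<Sum>i\<in>UNIV. \<Sum>j\<in>UNIV. t $ i * t $ j * (X \<omega> $ i * X \<omega> $ j))" for \<omega>
    by (simp add: inner_vec_def power2_eq_square sum_product mult_ac)
  then show ?thesis
    using int by (simp add: inner_vec_def matrix_vector_mult_def sum_distrib_left mult_ac)
qed

text \<open>The first conjunct makes the supremum in the limit a genuine maximum for every value of
  \<open>H\<close>. As 0 belongs to \<open>K\<close>, that maximum is nonnegative and its passage to
  \<open>ennreal\<close> loses nothing.\<close>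

theorem proposition4:
  fixes M :: "'a measure" and N :: "'b measure"
    and W :: "'a \<Rightarrow> real^'m" and Ws :: "nat \<Rightarrow> 'a \<Rightarrow> real^'m"
    and h :: "real^'m \<Rightarrow> real^'l \<Rightarrow> real^'r"
    and Dh :: "real^'m \<Rightarrow> real^'m^'r"
    and \<theta> :: "real^'l"
    and p q :: ennreal
    and f :: "real^'m \<Rightarrow> ennreal"
    and H :: "'b \<Rightarrow> real^'r"
    and K :: "(real^'r) set"
  assumes "prob_space M"
    and "W \<in> borel_measurable M"
    and "prob_space.indep_vars M (\<lambda>_. borel) Ws UNIV"
    and "\<And>i. distr M borel (Ws i) = distr M borel W"
    and "\<And>n. AE \<omega> in M. inj_on (\<lambda>i. Ws i \<omega>) {..<n}"
    and A1: "q \<ge> 1" "1 / p + 1 / q = 1"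
    and A2: "integrable M (\<lambda>\<omega>. h (W \<omega>) \<theta>)" "(\<integral>\<omega>. h (W \<omega>) \<theta> \<partial>M) = 0"
      "integrable M (\<lambda>\<omega>. (norm (h (W \<omega>) \<theta>))\<^sup>2)"
    and A3: "\<And>w. ((\<lambda>u. h u \<theta>) has_derivative (\<lambda>v. Dh w *v v)) (at w)"
      "continuous_on UNIV Dh"
    and A4: "\<And>\<zeta>. \<zeta> \<noteq> 0 \<Longrightarrow> \<P>(\<omega> in M. lp_norm p (\<zeta> v* Dh (W \<omega>)) > 0) > 0"
    and density: "distributed M lborel W f" "AE w in lborel. f w > 0"
    and "prob_space N"
    and "multivariate_normal N H 0 (\<chi> i j. \<integral>\<omega>. h (W \<omega>) \<theta> $ i * h (W \<omega>) \<theta> $ j \<partial>M)"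
  defines "K \<equiv> {\<zeta>. \<P>(\<omega> in M. lp_norm p (\<zeta> v* Dh (W \<omega>)) > 1) = 0}"
  shows "(\<forall>x. \<exists>\<zeta>\<in>K. \<forall>\<zeta>'\<in>K. \<zeta>' \<bullet> x \<le> \<zeta> \<bullet> x) \<and>
    converges_in_distribution
      M (\<lambda>n \<omega>. ennreal (sqrt (real n)) *
           profile_function (\<lambda>u w. lp_norm q (u - w)) h n (\<lambda>i. Ws i \<omega>) \<theta>)
      N (\<lambda>\<omega>. ennreal (SUP \<zeta>\<in>K. \<zeta> \<bullet> H \<omega>))"
proof -
  interpret prob_space M by fact
  interpret continuous_metric "\<lambda>u w :: real^'m. lp_norm q (u - w)"
    using A1(2) by (rule continuous_metric_lp_norm)
  let ?g = "\<lambda>u. h u \<theta>"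
  let ?L = "lipschitz_dual (\<lambda>u w. lp_norm q (u - w)) ?g"
  \<comment> \<open>The orientations \<open>b - a\<close> and \<open>a - b\<close> of the cost agree
    by symmetry.\<close>
  have K: "K = ?L"
    unfolding K_def lipschitz_dual_def almost_sure_lipschitz_dual[OF A1(2) A3 density]
    by (intro Collect_cong) (metis cost_sym)
  have g: "continuous_on UNIV ?g"
    using A3(1) by (intro continuous_at_imp_continuous_on ballI has_derivative_continuous)
  \<comment> \<open>If \<open>\<zeta>\<close> were orthogonal to all increments of \<open>h\<close>,
    then \<open>\<zeta> v* Dh w\<close> would vanish at every \<open>w\<close>, against A4. This is
    the condition that yields compactness.\<close>
  have "\<exists>a b. \<zeta> \<bullet> (h b \<theta> - h a \<theta>) \<noteq> 0" if "\<zeta> \<noteq> 0" for \<zeta>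
  proof (rule ccontr)
    assume "\<nexists>a b. \<zeta> \<bullet> (h b \<theta> - h a \<theta>) \<noteq> 0"
    then have "\<zeta> \<bullet> (Dh w *v v) \<le> 0" for w v
      by (intro inner_has_derivative_le[OF A3(1)]) simp
    then have "(\<zeta> v* Dh w) \<bullet> (\<zeta> v* Dh w) \<le> 0" for w
      by (simp add: dot_lmul_matrix)
    then have "\<zeta> v* Dh w = 0" for w
      by (metis inner_gt_zero_iff not_less)
    then show False
      using A4[OF that] by simp
  qed
  then have compact: "compact ?L"
    by (rule compact_lipschitz_dual)
  interpret profile_sample "\<lambda>u w :: real^'m. lp_norm q (u - w)" M W Ws h \<theta>
    using assms prob_open_pos[OF density] g compact by unfold_locales auto
  have max: "\<exists>\<zeta>\<in>K. \<forall>\<zeta>'\<in>K. \<zeta>' \<bullet> x \<le> \<zeta> \<bullet> x" for x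
    unfolding K by (rule support_function_attained[OF compact dual_nonempty, of x]) blast
  have H: "H \<in> borel_measurable N"
    using assms(17) by (simp add: multivariate_normal_def)
  have X: "(\<lambda>\<omega>. h (W \<omega>) \<theta>) \<in> borel_measurable M"
    by simp
  note normal = assms(17)[unfolded multivariate_normal_def Let_def inner_covariance_eq[OF X A2(3)]]
  have "converges_in_distribution M R N (\<lambda>\<omega>. ennreal (S (H \<omega>)))"
  proof (rule profile_function_converges_in_distribution[OF \<open>prob_space N\<close> H])
    fix t
    let ?v = "\<integral>\<omega>. (t \<bullet> h (W \<omega>) \<theta>)\<^sup>2 \<partial>M"
    from normal have *: "?v > 0 \<and> distributed N lborel (\<lambda>\<omega>. t \<bullet> H \<omega>) (\<lambda>x. ennreal (normal_density (t \<bullet> 0) (sqrt ?v) x)) \<or>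
        ?v = 0 \<and> (AE \<omega> in N. t \<bullet> H \<omega> = t \<bullet> 0)"
      by blast
    then show "distributed N lborel (\<lambda>\<omega>. t \<bullet> H \<omega>) (\<lambda>x. ennreal (normal_density 0 (sqrt ?v) x))" if "?v > 0"
      using that by auto
    from * show "AE \<omega> in N. t \<bullet> H \<omega> = 0" if "?v = 0"
      using that by auto
  qed
  then show ?thesis
    using max by (simp add: K support_function_def)
qed

end
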